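(* Consider the closed-loop uncertain 2D discrete switched system with state delays, for $i,j\in\mathbb{Z}_+$ and $m=i+j$, $$\begin{bmatrix} x^h(i+1,j)\\ x^v(i,j+1)\end{bmatrix}=\big(\hat A^{\sigma(m)}+B^{\sigma(m)}\Omega^{\sigma(m)}K^{\sigma(m)}\big)\begin{bmatrix} x^h(i,j)\\ x^v(i,j)\end{bmatrix}+\hat A_d^{\sigma(m)}\begin{bmatrix} x^h(i-d_h(i),j)\\ x^v(i,j-d_v(j))\end{bmatrix},$$ with the data, boundary conditions, uncertainties and actuator fault matrices described in the context. Let positive scalars $\alpha<1$, $\delta_k$, $\varepsilon_k$ ($k\in\underline N$) be given. Suppose that there exist, for $k\in\underline N$, positive definite symmetric matrices $\bar P^k=\mathrm{diag}\{\bar P_h^k,\bar P_v^k\}$, $\bar Q_1^k=\mathrm{diag}\{\bar Q_{1h}^k,\bar Q_{1v}^k\}$, $\bar Q_2^k=\mathrm{diag}\{\bar Q_{2h}^k,\bar Q_{2v}^k\}$, $\bar W_1^k=\mathrm{diag}\{\bar W_{1h}^k,\bar W_{1v}^k\}$, $\bar W_2^k=\mathrm{diag}\{\bar W_{2h}^k,\bar W_{2v}^k\}$ and, for $\bullet\in\{h,v\}$, $$\bar X_\bullet^k=\begin{bmatrix}\bar X_{11\bullet}^k&\bar X_{12\bullet}^k\\ *&\bar X_{22\bullet}^k\end{bmatrix},\qquad \bar Y_\bullet^k=\begin{bmatrix}\bar Y_{11\bullet}^k&\bar Y_{12\bullet}^k\\ *&\bar Y_{22\bullet}^k\end{bmatrix},$$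 and any matrices $$\bar M_\bullet^k=\begin{bmatrix}\bar M_{1\bullet}^k\\ \bar M_{2\bullet}^k\end{bmatrix},\quad \bar N_\bullet^k=\begin{bmatrix}\bar N_{1\bullet}^k\\ \bar N_{2\bullet}^k\end{bmatrix},\quad \bar S_\bullet^k=\begin{bmatrix}\bar S_{1\bullet}^k\\ \bar S_{2\bullet}^k\end{bmatrix},\quad \Upsilon^k,$$ and $Z=\mathrm{diag}\{Z_h,Z_v\}$ (the same for all $k$), all of appropriate dimensions, such that for every $k\in\underline N$ $$\bar\Phi=\begin{bmatrix}\bar\Phi_1&\bar\Phi_2^T&\bar\Phi_2^T&\bar\Phi_3^T&\mathrm{T}^k&\bar\Phi_7^T\\ *&\bar\Phi_4&\bar\Phi_6&\bar\Phi_6&0&0\\ *&*&\bar\Phi_5&\bar\Phi_6&0&0\\ *&*&*&\Pi^k&0&0\\ *&*&*&*&-\delta_kI&0\\ *&*&*&*&*&-\varepsilon_k\Xi^k\end{bmatrix}<0$$ and $$\bar\Psi^k=\mathrm{diag}\{\bar\Psi_{1h}^k,\bar\Psi_{2h}^k,\bar\Psi_{3h}^k,\bar\Psi_{1v}^k,\bar\Psi_{2v}^k,\bar\Psi_{3v}^k\}\ge 0,$$ where, with $\Lambda_1=\mathrm{diag}\{d_{hL}I_h,d_{vL}I_v\}$, $\Lambda_2=\mathrm{diag}\{(d_{hH}-d_{hL})I_h,(d_{vH}-d_{vL})I_v\}$, $\Lambda_3=\mathrm{diag}\{\alpha^{d_{hL}}I_h,\alpha^{d_{vL}}I_v\}$,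 $\Lambda_4=\mathrm{diag}\{\alpha^{d_{hH}}I_h,\alpha^{d_{vH}}I_v\}$, and with $\bar X_{ab}^k=\mathrm{diag}\{\bar X_{abh}^k,\bar X_{abv}^k\}$, $\bar Y_{ab}^k=\mathrm{diag}\{\bar Y_{abh}^k,\bar Y_{abv}^k\}$ for $ab\in\{11,12,22\}$, $\bar M_a^k=\mathrm{diag}\{\bar M_{ah}^k,\bar M_{av}^k\}$, $\bar N_a^k=\mathrm{diag}\{\bar N_{ah}^k,\bar N_{av}^k\}$, $\bar S_a^k=\mathrm{diag}\{\bar S_{ah}^k,\bar S_{av}^k\}$ for $a\in\{1,2\}$, $$\bar\Phi_1=\begin{bmatrix}\bar\Phi_{11}&\bar\Phi_{12}&\bar\Phi_{13}&\bar\Phi_{14}\\ *&\bar\Phi_{22}&\bar\Phi_{23}&\bar\Phi_{24}\\ *&*&\bar\Phi_{33}&0\\ *&*&*&\bar\Phi_{44}\end{bmatrix},$$ $\bar\Phi_{11}=\bar Q_1^k+\bar Q_2^k+\Lambda_3(\bar M_1^k+\bar M_1^{kT}+\Lambda_1\bar X_{11}^k)+\Lambda_2\Lambda_4\bar Y_{11}^k-\alpha\bar P^k$, $\bar\Phi_{12}=\Lambda_3(\Lambda_1\bar X_{12}^k+\bar M_2^{kT})+\Lambda_4(\bar N_1^k-\bar S_1^k+\Lambda_2\bar Y_{12}^k)$, $\bar\Phi_{13}=-\Lambda_3\bar M_1^k+\Lambda_4\bar S_1^k$, $\bar\Phi_{14}=-\Lambda_4\bar N_1^k$, $\bar\Phi_{22}=\Lambda_1\Lambda_3\bar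 X_{22}^k+\Lambda_4(\bar N_2^k+\bar N_2^{kT}-\bar S_2^k-\bar S_2^{kT}+\Lambda_2\bar Y_{22}^k)$, $\bar\Phi_{23}=-\Lambda_3\bar M_2^k+\Lambda_4\bar S_2^k$, $\bar\Phi_{24}=-\Lambda_4\bar N_2^k$, $\bar\Phi_{33}=-\Lambda_3\bar Q_1^k$, $\bar\Phi_{44}=-\Lambda_4\bar Q_2^k$, $\bar\Phi_2=\begin{bmatrix}(A^k-I)Z+B^k\Omega_0^k\Upsilon^k& A_d^kZ&0&0\end{bmatrix}$, $\bar\Phi_3=\begin{bmatrix}A^kZ+B^k\Omega_0^k\Upsilon^k& A_d^kZ&0&0\end{bmatrix}$, $\bar\Phi_6=\delta_kH^kH^{kT}+\varepsilon_kB^k\Omega_0^k\Xi^k\Omega_0^{kT}B^{kT}$, $\bar\Phi_4=-\Lambda_1^{-1}\bar W_1^k+\bar\Phi_6$, $\bar\Phi_5=-\Lambda_2^{-1}\bar W_2^k+\bar\Phi_6$, $\Pi^k=-Z-Z^T+\bar P^k+\bar\Phi_6$, $\mathrm{T}^k=\begin{bmatrix}E^kZ&E_d^kZ&0&0\end{bmatrix}^T$, $\bar\Phi_7=\begin{bmatrix}\Xi^k\Upsilon^k&0&0&0\end{bmatrix}$, and for $\bullet\in\{h,v\}$ $$\bar\Psi_{1\bullet}^k=\begin{bmatrix}\bar X_\bullet^k&\bar M_\bullet^k\\ *&Z_\bullet+Z_\bullet^T-\bar W_{1\bullet}^k\end{bmatrix},\quad \bar\Psi_{2\bullet}^k=\begin{bmatrix}\bar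 Y_\bullet^k&\bar N_\bullet^k\\ *&Z_\bullet+Z_\bullet^T-\bar W_{2\bullet}^k\end{bmatrix},\quad \bar\Psi_{3\bullet}^k=\begin{bmatrix}\bar Y_\bullet^k&\bar S_\bullet^k\\ *&Z_\bullet+Z_\bullet^T-\bar W_{2\bullet}^k\end{bmatrix}.$$ Then, under the reliable controller $$u^f(i,j)=\Omega^{\sigma(m)}K^{\sigma(m)}x(i,j),\qquad K^k=\Upsilon^kZ^{-1},$$ and the average dwell time scheme $$\tau_a>\tau_a^*=\frac{\ln\mu}{-\ln\alpha},$$ the corresponding closed-loop system is exponentially stable, where $\mu\ge1$ satisfies, for all $k,l\in\underline N$, $$\bar P^k\le\mu\bar P^l,\ \bar P^l\le\mu\bar P^k,\ \bar Q_1^k\le\mu\bar Q_1^l,\ \bar Q_1^l\le\mu\bar Q_1^k,\ \bar Q_2^k\le\mu\bar Q_2^l,\ \bar Q_2^l\le\mu\bar Q_2^k,$$ $$\bar W_1^k\le\mu\bar W_1^l,\ \bar W_1^l\le\mu\bar W_1^k,\ \bar W_2^k\le\mu\bar W_2^l,\ \bar W_2^l\le\mu\bar W_2^k.$$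
   Context: Notation. $\mathbb{Z}_+$ is the set of nonnegative integers; $\|\cdot\|$ is the Euclidean norm; $X>Y$ (resp. $X\ge Y$) means $X-Y$ is positive definite (resp. positive semidefinite); $*$ in a symmetric matrix denotes the block determined by symmetry; $M^{kT}=(M^k)^T$; $I_h,I_v$ are the identity matrices of sizes $n_1,n_2$. System. $x^h(i,j)\in\mathbb{R}^{n_1}$ (horizontal state), $x^v(i,j)\in\mathbb{R}^{n_2}$ (vertical state), $x(i,j)=[x^h(i,j)^T\ x^v(i,j)^T]^T\in\mathbb{R}^n$, $n=n_1+n_2$. The switching signal $\sigma$ takes values in $\underline N=\{1,\dots,N\}$ and is evaluated at $m=i+j$; $\sigma(m)=k$ means the $k$th subsystem is active. The open-loop plant is $[x^h(i+1,j)^T\ x^v(i,j+1)^T]^T=\hat A^{\sigma(m)}x(i,j)+\hat A_d^{\sigma(m)}[x^h(i-d_h(i),j)^T\ x^v(i,j-d_v(j))^T]^T+B^{\sigma(m)}u^f(i,j)$, with $B^k$ of appropriate dimensions. Delays. $d_h(i),d_v(j)$ are the delays along the horizontal and vertical directions, with $d_{hL}\le d_h(i)\le d_{hH}$ and $d_{vL}\le d_v(j)\le d_{vH}$, where $d_{hL},d_{hH},d_{vL},d_{vH}$ are the lower and upper delay bounds. Uncertainties. $\hat A^k=A^k+H^kF^k(i,j)E^k$, $\hat A_d^k=A_d^k+H^kF^k(i,j)E_d^k$, where $A^k,A_d^k\in\mathbb{R}^{n\times n}$, $H^k\in\mathbb{R}^{n\times p}$, $E^k,E_d^k\in\mathbb{R}^{q\times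 n}$ are constant matrices and $F^k(i,j)\in\mathbb{R}^{p\times q}$ is an unknown matrix representing parameter uncertainty, with $F^k(i,j)^TF^k(i,j)\le I$. Actuator faults. $u^f(i,j)=\Omega^{\sigma(m)}u(i,j)$ with $u(i,j)=K^{\sigma(m)}x(i,j)$ the control input to be designed, and $\Omega^k=\mathrm{diag}\{\omega_{k1},\dots,\omega_{kn}\}$ with $0\le\omega_{Lkl}\le\omega_{kl}\le\omega_{Hkl}$. Put $\Omega_0^k=\mathrm{diag}\{\tilde\omega_{k1},\dots,\tilde\omega_{kn}\}$ with $\tilde\omega_{kl}=\frac12(\omega_{Lkl}+\omega_{Hkl})$, and $\Xi^k=\mathrm{diag}\{\xi_{k1},\dots,\xi_{kn}\}$ with $\xi_{kl}=\frac{\omega_{Hkl}-\omega_{Lkl}}{\omega_{Hkl}+\omega_{Lkl}}$. Boundary conditions. For finite positive integers $z_1,z_2$ and given vectors $h_{ij},v_{ij}$: $x^h(i,j)=h_{ij}$ for $0\le j\le z_1$, $-d_{hH}\le i\le0$; $x^h(i,j)=0$ for $j>z_1$, $-d_{hH}\le i\le0$; $x^v(i,j)=v_{ij}$ for $0\le i\le z_2$, $-d_{vH}\le j\le0$; $x^v(i,j)=0$ for $i>z_2$, $-d_{vH}\le j\le0$. Exponential stability. The system is exponentially stable under $\sigma$ if for a given $z\ge0$ there exists a positive constant $c$ such that $$\sum_{i+j=D}\|x(i,j)\|^2\le\eta e^{-c(D-z)}\sum_{i+j=z}\|x(i,j)\|_C^2$$ holds for all $D\ge z$ and a positive constant $\eta$,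 where $$\sum_{i+j=z}\|x(i,j)\|_C^2:=\sup_{\substack{-d_{hH}<\theta_h\le0\\ -d_{vH}<\theta_v\le0}}\ \sum_{i+j=z}\Big\{\|x^h(i-\theta_h,j)\|^2+\|x^v(i,j-\theta_v)\|^2,\ \|\eta^h(i-\theta_h,j)\|^2+\|\eta^v(i,j-\theta_v)\|^2\Big\},$$ with $\eta^h(i-\theta_h,j)=x^h(i-\theta_h+1,j)-x^h(i-\theta_h,j)$ and $\eta^v(i,j-\theta_v)=x^v(i,j-\theta_v+1)-x^v(i,j-\theta_v)$; the supremum is over both quantities listed in the braces. Average dwell time. For any $i+j=D\ge z=i_z+j_z$, let $N_{\sigma(m)}(z,D)$ be the number of switches of $\sigma$ on the interval $(z,D)$. If $N_{\sigma(m)}(z,D)\le N_0+\frac{D-z}{\tau_a}$ holds for given $N_0\ge0$, $\tau_a\ge0$, then $\tau_a$ is called the average dwell time and $N_0$ the chatter bound.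
   Formalization: The initial norm is taken over past values x^h(i+θ_h,j), x^v(i,j+θ_v) (likewise η) instead of i−θ_h, j−θ_v, and stability is claimed only for z ≥ max(z_1,z_2); with the printed sign, or for smaller z, the right side can vanish while the left side is positive. *)

theory Defs
  imports "HOL-Analysis.Analysis"
begin

text \<open>
  Throughout, the index types \<open>'h\<close> and \<open>'v\<close> have \<open>n\<^sub>1 = CARD('h)\<close> and \<open>n\<^sub>2 = CARD('v)\<close> elements, so
  that \<open>'h + 'v\<close> indexes the full state and block matrices are indexed by sum types.
\<close>

type_synonym ('r, 'c) rmat = "real^'c^'r"

section \<open>Definiteness and block matrices\<close>

definition pos_def :: "('n::finite, 'n) rmat \<Rightarrow> bool" where
  "pos_def X \<longleftrightarrow> transpose X = X \<and> (\<forall>x. x \<noteq> 0 \<longrightarrow> 0 < x \<bullet> (X *v x))"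

definition pos_semidef :: "('n::finite, 'n) rmat \<Rightarrow> bool" where
  "pos_semidef X \<longleftrightarrow> transpose X = X \<and> (\<forall>x. 0 \<le> x \<bullet> (X *v x))"

definition mat_less :: "('n::finite, 'n) rmat \<Rightarrow> ('n, 'n) rmat \<Rightarrow> bool" (infix "\<prec>\<^sub>m" 50) where
  "X \<prec>\<^sub>m Y \<longleftrightarrow> pos_def (Y - X)"

definition mat_le :: "('n::finite, 'n) rmat \<Rightarrow> ('n, 'n) rmat \<Rightarrow> bool" (infix "\<preceq>\<^sub>m" 50) where
  "X \<preceq>\<^sub>m Y \<longleftrightarrow> pos_semidef (Y - X)"

definition within_factor :: "real \<Rightarrow> ('n::finite, 'n) rmat \<Rightarrow> ('n, 'n) rmat \<Rightarrow> bool" where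
  "within_factor \<mu> X Y \<longleftrightarrow> X \<preceq>\<^sub>m \<mu> *\<^sub>R Y \<and> Y \<preceq>\<^sub>m \<mu> *\<^sub>R X"

definition diag_mat :: "('n::finite \<Rightarrow> real) \<Rightarrow> ('n, 'n) rmat" where
  "diag_mat d = (\<chi> i j. if i = j then d i else 0)"

definition vjoin :: "real^'a::finite \<Rightarrow> real^'b::finite \<Rightarrow> real^('a + 'b)" where
  "vjoin x y = (\<chi> i. case i of Inl a \<Rightarrow> x $ a | Inr b \<Rightarrow> y $ b)"

definition hcat :: "('r::finite, 'a::finite) rmat \<Rightarrow> ('r, 'b::finite) rmat \<Rightarrow> ('r, 'a + 'b) rmat" where
  "hcat X Y = (\<chi> i. vjoin (X $ i) (Y $ i))"

definition vcat :: "('a::finite, 'c::finite) rmat \<Rightarrow> ('b::finite, 'c) rmat \<Rightarrow> ('a + 'b, 'c) rmat" where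
  "vcat X Y = (\<chi> i. case i of Inl a \<Rightarrow> X $ a | Inr b \<Rightarrow> Y $ b)"

definition sym_block ::
  "('a::finite, 'a) rmat \<Rightarrow> ('a, 'b::finite) rmat \<Rightarrow> ('b, 'b) rmat \<Rightarrow> ('a + 'b, 'a + 'b) rmat" where
  "sym_block X Y W = vcat (hcat X Y) (hcat (transpose Y) W)"

definition block_diag ::
  "('a::finite, 'a) rmat \<Rightarrow> ('b::finite, 'b) rmat \<Rightarrow> ('a + 'b, 'a + 'b) rmat" where
  "block_diag X W = sym_block X 0 W"

section \<open>The switched system\<close>

text \<open>
  \<open>'u\<close> indexes the input channels, i.e. the diagonal of the fault matrix; \<open>'p\<close> and \<open>'q\<close> index the
  rows and columns of the uncertainty.
\<close>

record ('h::finite, 'v::finite, 'u::finite, 'p::finite, 'q::finite) subsystem =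
  A_mat :: "('h + 'v, 'h + 'v) rmat"
  Ad_mat :: "('h + 'v, 'h + 'v) rmat"
  B_mat :: "('h + 'v, 'u) rmat"
  H_mat :: "('h + 'v, 'p) rmat"
  E_mat :: "('q, 'h + 'v) rmat"
  Ed_mat :: "('q, 'h + 'v) rmat"

definition A_hat where
  "A_hat S F = A_mat S + H_mat S ** (F :: ('p::finite, 'q::finite) rmat) ** E_mat S"

definition Ad_hat where
  "Ad_hat S F = Ad_mat S + H_mat S ** (F :: ('p::finite, 'q::finite) rmat) ** Ed_mat S"

text \<open>
  The horizontal state lives on \<open>{-d\<^sub>h\<^sub>H..} \<times> \<nat>\<close> and the vertical one on \<open>\<nat> \<times> {-d\<^sub>v\<^sub>H..}\<close>; values at
  arguments below \<open>-d\<^sub>h\<^sub>H\<close> and \<open>-d\<^sub>v\<^sub>H\<close> are never used.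
\<close>

type_synonym 'h hstate = "int \<Rightarrow> nat \<Rightarrow> real^'h"
type_synonym 'v vstate = "nat \<Rightarrow> int \<Rightarrow> real^'v"

definition closed_loop_equation ::
  "(nat \<Rightarrow> ('h::finite, 'v::finite, 'u::finite, 'p::finite, 'q::finite) subsystem) \<Rightarrow>
   (nat \<Rightarrow> nat \<Rightarrow> nat \<Rightarrow> ('p, 'q) rmat) \<Rightarrow> (nat \<Rightarrow> ('u, 'u) rmat) \<Rightarrow> (nat \<Rightarrow> ('u, 'h + 'v) rmat) \<Rightarrow>
   (nat \<Rightarrow> nat) \<Rightarrow> (nat \<Rightarrow> nat) \<Rightarrow> (nat \<Rightarrow> nat) \<Rightarrow> 'h hstate \<Rightarrow> 'v vstate \<Rightarrow> bool" where
  "closed_loop_equation S F \<Omega> K \<sigma> dh dv xh xv \<longleftrightarrow>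
     (\<forall>i j. let k = \<sigma> (i + j) in
        vjoin (xh (int i + 1) j) (xv i (int j + 1)) =
          (A_hat (S k) (F k i j) + B_mat (S k) ** \<Omega> k ** K k)
             *v vjoin (xh (int i) j) (xv i (int j))
        + Ad_hat (S k) (F k i j)
             *v vjoin (xh (int i - int (dh i)) j) (xv i (int j - int (dv j))))"

definition boundary_conditions ::
  "nat \<Rightarrow> nat \<Rightarrow> nat \<Rightarrow> nat \<Rightarrow> 'h::finite hstate \<Rightarrow> 'v::finite vstate \<Rightarrow> 'h hstate \<Rightarrow> 'v vstate \<Rightarrow> bool" where
  "boundary_conditions dhH dvH z1 z2 h v xh xv \<longleftrightarrow>
     (\<forall>i j. - int dhH \<le> i \<and> i \<le> 0 \<longrightarrow> xh i j = (if j \<le> z1 then h i j else 0)) \<and>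
     (\<forall>i j. - int dvH \<le> j \<and> j \<le> 0 \<longrightarrow> xv i j = (if i \<le> z2 then v i j else 0))"

section \<open>Exponential stability and average dwell time\<close>

definition diag_energy :: "'h::finite hstate \<Rightarrow> 'v::finite vstate \<Rightarrow> nat \<Rightarrow> real" where
  "diag_energy xh xv D =
     (\<Sum>i\<le>D. (norm (vjoin (xh (int i) (D - i)) (xv i (int (D - i)))))\<^sup>2)"

text \<open>
  The supremum runs over the recorded history: with \<open>-d\<^sub>h\<^sub>H < \<theta>\<^sub>h \<le> 0\<close> the shifted horizontal index is
  \<open>i + \<theta>\<^sub>h\<close>. (Written with \<open>i - \<theta>\<^sub>h\<close>, the offset would have to range over \<open>0 \<le> \<theta>\<^sub>h < d\<^sub>h\<^sub>H\<close>.)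
\<close>

definition diag_norm_C :: "nat \<Rightarrow> nat \<Rightarrow> 'h::finite hstate \<Rightarrow> 'v::finite vstate \<Rightarrow> nat \<Rightarrow> real" where
  "diag_norm_C dhH dvH xh xv z =
     (let \<eta>h = (\<lambda>i j. xh (i + 1) j - xh i j);
          \<eta>v = (\<lambda>i j. xv i (j + 1) - xv i j)
      in SUP (\<theta>h, \<theta>v) \<in> {- int dhH <.. 0} \<times> {- int dvH <.. 0}.
           max (\<Sum>i\<le>z. (norm (xh (int i + \<theta>h) (z - i)))\<^sup>2 + (norm (xv i (int (z - i) + \<theta>v)))\<^sup>2)
               (\<Sum>i\<le>z. (norm (\<eta>h (int i + \<theta>h) (z - i)))\<^sup>2 + (norm (\<eta>v i (int (z - i) + \<theta>v)))\<^sup>2))"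

text \<open>
  The system enters through the set \<open>T\<close> of its trajectories. The constants are uniform over
  trajectories and depend on the initial diagonal \<open>z\<close>. Boundary data on rows \<open>j > z\<close> and columns
  \<open>i > z\<close> act on later diagonals but do not enter \<open>diag_norm_C\<close> at \<open>z\<close>; the inequality is therefore
  meant for \<open>z\<close> beyond the support of the boundary data, \<open>z \<ge> max z\<^sub>1 z\<^sub>2\<close>.
\<close>

definition exponentially_stable ::
  "nat \<Rightarrow> nat \<Rightarrow> nat \<Rightarrow> ('h::finite hstate \<times> 'v::finite vstate) set \<Rightarrow> bool" where
  "exponentially_stable dhH dvH z T \<longleftrightarrow>
     (\<exists>c>0. \<exists>\<eta>>0. \<forall>(xh, xv)\<in>T. \<forall>D\<ge>z.
        diag_energy xh xv D \<le> \<eta> * exp (- c * (real D - real z)) * diag_norm_C dhH dvH xh xv z)"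

definition switches :: "(nat \<Rightarrow> nat) \<Rightarrow> nat \<Rightarrow> nat \<Rightarrow> nat" where
  "switches \<sigma> z D = card {m. z < m \<and> m < D \<and> \<sigma> m \<noteq> \<sigma> (m - 1)}"

definition average_dwell_time :: "(nat \<Rightarrow> nat) \<Rightarrow> real \<Rightarrow> real \<Rightarrow> bool" where
  "average_dwell_time \<sigma> \<tau>a N0 \<longleftrightarrow> 0 \<le> N0 \<and> 0 \<le> \<tau>a \<and>
     (\<forall>z D. z \<le> D \<longrightarrow> real (switches \<sigma> z D) \<le> N0 + (real D - real z) / \<tau>a)"

section \<open>The matrix inequalities\<close>

definition Omega0 :: "('u::finite \<Rightarrow> real) \<Rightarrow> ('u \<Rightarrow> real) \<Rightarrow> ('u, 'u) rmat" where
  "Omega0 \<omega>L \<omega>H = diag_mat (\<lambda>l. (\<omega>L l + \<omega>H l) / 2)"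

definition Xi :: "('u::finite \<Rightarrow> real) \<Rightarrow> ('u \<Rightarrow> real) \<Rightarrow> ('u, 'u) rmat" where
  "Xi \<omega>L \<omega>H = diag_mat (\<lambda>l. (\<omega>H l - \<omega>L l) / (\<omega>H l + \<omega>L l))"

text \<open>
  The (barred) decision variables of one subsystem belonging to one direction, \<open>'d = 'h\<close> or
  \<open>'d = 'v\<close>. \<open>Z\<close> is common to all subsystems and \<open>\<Upsilon>\<close> is not split by direction, so neither is a field.
\<close>

record ('d::finite) lmi_vars =
  Pb :: "('d, 'd) rmat"
  Q1b :: "('d, 'd) rmat"
  Q2b :: "('d, 'd) rmat"
  W1b :: "('d, 'd) rmat"
  W2b :: "('d, 'd) rmat"
  X11b :: "('d, 'd) rmat"
  X12b :: "('d, 'd) rmat"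
  X22b :: "('d, 'd) rmat"
  Y11b :: "('d, 'd) rmat"
  Y12b :: "('d, 'd) rmat"
  Y22b :: "('d, 'd) rmat"
  M1b :: "('d, 'd) rmat"
  M2b :: "('d, 'd) rmat"
  N1b :: "('d, 'd) rmat"
  N2b :: "('d, 'd) rmat"
  S1b :: "('d, 'd) rmat"
  S2b :: "('d, 'd) rmat"

definition Xb :: "'d::finite lmi_vars \<Rightarrow> ('d + 'd, 'd + 'd) rmat" where
  "Xb V = sym_block (X11b V) (X12b V) (X22b V)"

definition Yb :: "'d::finite lmi_vars \<Rightarrow> ('d + 'd, 'd + 'd) rmat" where
  "Yb V = sym_block (Y11b V) (Y12b V) (Y22b V)"

definition Phi_bar ::
  "real \<Rightarrow> nat \<Rightarrow> nat \<Rightarrow> nat \<Rightarrow> nat \<Rightarrow> real \<Rightarrow> real \<Rightarrow>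
   ('h::finite, 'v::finite, 'u::finite, 'p::finite, 'q::finite) subsystem \<Rightarrow>
   ('u \<Rightarrow> real) \<Rightarrow> ('u \<Rightarrow> real) \<Rightarrow> 'h lmi_vars \<Rightarrow> 'v lmi_vars \<Rightarrow>
   ('h + 'v, 'h + 'v) rmat \<Rightarrow> ('u, 'h + 'v) rmat \<Rightarrow> _" where
  "Phi_bar \<alpha> dhL dhH dvL dvH \<delta> \<epsilon> S \<omega>L \<omega>H Vh Vv Z \<Upsilon> = (
    let
      A = A_mat S; Ad = Ad_mat S; B = B_mat S; H = H_mat S; E = E_mat S; Ed = Ed_mat S;
      \<Omega>0 = Omega0 \<omega>L \<omega>H; \<Xi> = Xi \<omega>L \<omega>H;
      P = block_diag (Pb Vh) (Pb Vv); Q1 = block_diag (Q1b Vh) (Q1b Vv); Q2 = block_diag (Q2b Vh) (Q2b Vv);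
      W1 = block_diag (W1b Vh) (W1b Vv); W2 = block_diag (W2b Vh) (W2b Vv);
      X11 = block_diag (X11b Vh) (X11b Vv); X12 = block_diag (X12b Vh) (X12b Vv); X22 = block_diag (X22b Vh) (X22b Vv);
      Y11 = block_diag (Y11b Vh) (Y11b Vv); Y12 = block_diag (Y12b Vh) (Y12b Vv); Y22 = block_diag (Y22b Vh) (Y22b Vv);
      M1 = block_diag (M1b Vh) (M1b Vv); M2 = block_diag (M2b Vh) (M2b Vv);
      N1 = block_diag (N1b Vh) (N1b Vv); N2 = block_diag (N2b Vh) (N2b Vv);
      S1 = block_diag (S1b Vh) (S1b Vv); S2 = block_diag (S2b Vh) (S2b Vv);
      \<Lambda>1 = block_diag (mat (real dhL)) (mat (real dvL));
      \<Lambda>2 = block_diag (mat (real dhH - real dhL)) (mat (real dvH - real dvL));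
      \<Lambda>3 = block_diag (mat (\<alpha> ^ dhL)) (mat (\<alpha> ^ dvL));
      \<Lambda>4 = block_diag (mat (\<alpha> ^ dhH)) (mat (\<alpha> ^ dvH));
      \<Phi>11 = Q1 + Q2 + \<Lambda>3 ** (M1 + transpose M1 + \<Lambda>1 ** X11) + \<Lambda>2 ** \<Lambda>4 ** Y11 - \<alpha> *\<^sub>R P;
      \<Phi>12 = \<Lambda>3 ** (\<Lambda>1 ** X12 + transpose M2) + \<Lambda>4 ** (N1 - S1 + \<Lambda>2 ** Y12);
      \<Phi>13 = - (\<Lambda>3 ** M1) + \<Lambda>4 ** S1;
      \<Phi>14 = - (\<Lambda>4 ** N1);
      \<Phi>22 = \<Lambda>1 ** \<Lambda>3 ** X22
            + \<Lambda>4 ** (N2 + transpose N2 - S2 - transpose S2 + \<Lambda>2 ** Y22);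
      \<Phi>23 = - (\<Lambda>3 ** M2) + \<Lambda>4 ** S2;
      \<Phi>24 = - (\<Lambda>4 ** N2);
      \<Phi>33 = - (\<Lambda>3 ** Q1);
      \<Phi>44 = - (\<Lambda>4 ** Q2);
      \<Phi>1 = sym_block \<Phi>11 (hcat \<Phi>12 (hcat \<Phi>13 \<Phi>14))
             (sym_block \<Phi>22 (hcat \<Phi>23 \<Phi>24)
               (sym_block \<Phi>33 0 \<Phi>44));
      \<Phi>2 = hcat ((A - mat 1) ** Z + B ** \<Omega>0 ** \<Upsilon>) (hcat (Ad ** Z) (hcat 0 0));
      \<Phi>3 = hcat (A ** Z + B ** \<Omega>0 ** \<Upsilon>) (hcat (Ad ** Z) (hcat 0 0));
      \<Phi>6 = \<delta> *\<^sub>R (H ** transpose H)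
           + \<epsilon> *\<^sub>R (B ** \<Omega>0 ** \<Xi> ** transpose \<Omega>0 ** transpose B);
      \<Phi>4 = - (matrix_inv \<Lambda>1 ** W1) + \<Phi>6;
      \<Phi>5 = - (matrix_inv \<Lambda>2 ** W2) + \<Phi>6;
      Pik = - Z - transpose Z + P + \<Phi>6;
      \<T> = transpose (hcat (E ** Z) (hcat (Ed ** Z) (hcat 0 0)));
      \<Phi>7 = hcat (\<Xi> ** \<Upsilon>) (hcat 0 (hcat 0 0))
    in
      sym_block \<Phi>1 (hcat (transpose \<Phi>2) (hcat (transpose \<Phi>2) (hcat (transpose \<Phi>3) (hcat \<T> (transpose \<Phi>7)))))
        (sym_block \<Phi>4 (hcat \<Phi>6 (hcat \<Phi>6 (hcat 0 0)))
          (sym_block \<Phi>5 (hcat \<Phi>6 (hcat 0 0))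
            (sym_block Pik (hcat 0 0)
              (sym_block (- (\<delta> *\<^sub>R mat 1)) 0
                (- (\<epsilon> *\<^sub>R \<Xi>)))))))"

definition Psi1 :: "'d::finite lmi_vars \<Rightarrow> ('d, 'd) rmat \<Rightarrow> (('d + 'd) + 'd, ('d + 'd) + 'd) rmat" where
  "Psi1 V Z = sym_block (Xb V) (vcat (M1b V) (M2b V)) (Z + transpose Z - W1b V)"

definition Psi2 :: "'d::finite lmi_vars \<Rightarrow> ('d, 'd) rmat \<Rightarrow> (('d + 'd) + 'd, ('d + 'd) + 'd) rmat" where
  "Psi2 V Z = sym_block (Yb V) (vcat (N1b V) (N2b V)) (Z + transpose Z - W2b V)"

definition Psi3 :: "'d::finite lmi_vars \<Rightarrow> ('d, 'd) rmat \<Rightarrow> (('d + 'd) + 'd, ('d + 'd) + 'd) rmat" where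
  "Psi3 V Z = sym_block (Yb V) (vcat (S1b V) (S2b V)) (Z + transpose Z - W2b V)"

definition Psi_bar ::
  "'h::finite lmi_vars \<Rightarrow> 'v::finite lmi_vars \<Rightarrow> ('h, 'h) rmat \<Rightarrow> ('v, 'v) rmat \<Rightarrow> _" where
  "Psi_bar Vh Vv Zh Zv =
     block_diag (Psi1 Vh Zh) (block_diag (Psi2 Vh Zh) (block_diag (Psi3 Vh Zh)
       (block_diag (Psi1 Vv Zv) (block_diag (Psi2 Vv Zv) (Psi3 Vv Zv)))))"

end

theory Submission
  imports Defs
begin

text \<open>
  The proof is a Lyapunov--Krasovskii argument carried out along the diagonals \<open>i + j = D\<close>.

  Fix one subsystem. Along a row, and likewise along a column, the state is a sequence of vectors
  with a delay between \<open>l\<close> and \<open>H\<close>. For such a sequence \<open>f\<close> the functional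
  \<open>V(i) = p (f i) + (discounted window sums of the form q1 of length l and of q2 of length H)
    + (nested discounted window sums of w1 and w2 of the increments of f)\<close>
  satisfies an explicit one-step estimate for \<open>V(i + 1) - \<alpha> V(i)\<close> (\<open>delay_functional_step\<close>): the window
  sums telescope up to boundary terms, and the remaining sums of increment forms are absorbed by
  the \<open>\<Psi>\<close> inequalities, which trade them for quadratic expressions in \<open>f i\<close>, \<open>f (i - l)\<close>,
  \<open>f (i - d)\<close> and \<open>f (i - H)\<close>. Here \<open>p, q1, q2\<close> are the barred matrices \<open>P, Q1, Q2\<close> conjugated by the
  inverse of \<open>Z\<close>, while \<open>w1, w2\<close> are given by the inverses of the barred \<open>W1, W2\<close>.

  Adding the estimates of both directions leaves the quadratic form of \<open>\<Phi>\<close> in disguise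
  (\<open>lmi_dissipation\<close>). Instead of Schur complements and congruences, \<open>\<Phi> < 0\<close> is evaluated at one vector
  whose last five blocks are chosen, ignoring the coupling \<open>\<Phi>\<^sub>6\<close>, as the corresponding Schur complements
  suggest. Completing squares then disposes of the uncertainty \<open>F\<close> (the \<open>\<delta>\<close> terms), the actuator faults
  (the \<open>\<epsilon>\<close> terms), and the difference between the inverses in the functional and their
  linearisations \<open>Z + Z\<^sup>T - W\<close>, \<open>Z + Z\<^sup>T - P\<close> in the hypotheses. Hence, on every cell,
  \<open>V\<^sub>h(i + 1, j) + V\<^sub>v(i, j + 1) \<le> \<alpha> (V\<^sub>h(i, j) + V\<^sub>v(i, j))\<close>.

  Summing over a diagonal \<open>D \<ge> z\<close> shifts the functional to the diagonal \<open>D + 1\<close>, because the new row and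
  the new column start from zero boundary data (\<open>diag_lyapunov_Suc\<close>). A switch costs a factor \<open>\<mu>\<close>
  (\<open>lyapunov_mono\<close>), and the dwell time makes \<open>\<mu>\<close> to the number of switches lose against \<open>\<alpha>\<close> to the
  elapsed time (\<open>dwell_time_decay\<close>).

  The induction starts at the diagonal \<open>z + 1\<close> rather than at \<open>z\<close>: a delay \<open>d\<^sub>H\<close> at diagonal \<open>z\<close>
  reaches values outside the window measured by \<open>diag_norm_C\<close>. Seen from \<open>z + 1\<close>, all delayed values lie
  in that window, and the values on \<open>z + 1\<close> itself are controlled by the increments \<open>\<eta>\<close> at
  offset \<open>0\<close> (\<open>history_le_diag_norm_C\<close>).
\<close>

section \<open>Block matrices\<close>

lemma inner_vjoin: "vjoin x y \<bullet> vjoin x' y' = x \<bullet> x' + y \<bullet> y'"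
  by (simp add: inner_vec_def vjoin_def sum.Plus UNIV_Plus_UNIV[symmetric] del: UNIV_Plus_UNIV)

lemma vjoin_add: "vjoin x y + vjoin x' y' = vjoin (x + x') (y + y')"
  and vjoin_diff: "vjoin x y - vjoin x' y' = vjoin (x - x') (y - y')"
  and vjoin_scaleR: "c *\<^sub>R vjoin x y = vjoin (c *\<^sub>R x) (c *\<^sub>R y)"
  and vjoin_zero: "vjoin 0 0 = 0"
  by (auto simp: vjoin_def vec_eq_iff split: sum.splits)

lemma vjoin_eq_iff: "vjoin x y = vjoin x' y' \<longleftrightarrow> x = x' \<and> y = y'"
  by (auto simp: vjoin_def vec_eq_iff split: sum.splits)

lemma vjoin_cases: obtains x y where "w = vjoin x y"
proof
  show "w = vjoin (\<chi> i. w $ Inl i) (\<chi> i. w $ Inr i)"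
    by (auto simp: vjoin_def vec_eq_iff split: sum.splits)
qed

lemma hcat_mult_vjoin: "hcat X Y *v vjoin x y = X *v x + Y *v y"
  by (simp add: vec_eq_iff matrix_vector_mult_def hcat_def vjoin_def sum.Plus UNIV_Plus_UNIV[symmetric] del: UNIV_Plus_UNIV)

lemma vcat_mult: "vcat X Y *v x = vjoin (X *v x) (Y *v x)"
  by (auto simp: vec_eq_iff matrix_vector_mult_def vcat_def vjoin_def split: sum.splits)

text \<open>
  The simplifier would otherwise turn \<open>transpose A *v x\<close> into \<open>x v* A\<close>, which hides the products with
  transposed blocks that \<open>inner_transpose\<close> moves to the other side of an inner product.
\<close>

declare transpose_matrix_vector [simp del]

lemma transpose_0: "transpose 0 = (0 :: real^'n^'m)"
  by (simp add: transpose_def vec_eq_iff)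

lemma inner_transpose: "x \<bullet> (transpose A *v y) = y \<bullet> (A *v (x :: real^'n))"
  unfolding transpose_matrix_vector by (subst inner_commute) (rule dot_lmul_matrix)

lemma sym_block_form: "vjoin x y \<bullet> (sym_block X Y W *v vjoin x y) = x \<bullet> (X *v x) + 2 * (x \<bullet> (Y *v y)) + y \<bullet> (W *v y)"
  by (simp add: sym_block_def vcat_mult hcat_mult_vjoin inner_vjoin inner_add_right inner_transpose)

lemma block_diag_mult_vjoin: "block_diag X W *v vjoin x y = vjoin (X *v x) (W *v y)"
  by (simp add: block_diag_def sym_block_def vcat_mult hcat_mult_vjoin transpose_0)

lemma mat_mult_vec: "(mat c :: real^'n::finite^'n) *v x = c *\<^sub>R x"
  by (simp add: vec_eq_iff matrix_vector_mult_def mat_def if_distrib if_distribR cong: if_cong)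

section \<open>Definite matrices\<close>

lemma pos_def_pos: "pos_def A \<Longrightarrow> x \<noteq> 0 \<Longrightarrow> 0 < x \<bullet> (A *v x)"
  by (simp add: pos_def_def)

lemma pos_def_nonneg: "pos_def A \<Longrightarrow> 0 \<le> x \<bullet> (A *v x)"
  by (cases "x = 0") (auto simp: pos_def_def less_imp_le)

lemma pos_def_symm: "pos_def A \<Longrightarrow> x \<bullet> (A *v y) = y \<bullet> (A *v x)"
  using inner_transpose[of x A y] by (simp add: pos_def_def)

lemma invertible_iff_ker: "invertible (A :: real^'n::finite^'n) \<longleftrightarrow> (\<forall>x. A *v x = 0 \<longrightarrow> x = 0)"
  using invertible_left_inverse matrix_left_invertible_ker by blast

lemma matrix_inv_mult:
  assumes "invertible (A :: real^'n::finite^'n)"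
  shows "A *v (matrix_inv A *v x) = x" "matrix_inv A *v (A *v x) = x"
proof -
  have "A ** matrix_inv A = mat 1 \<and> matrix_inv A ** A = mat 1"
    using assms unfolding invertible_def matrix_inv_def by (rule someI_ex)
  then show "A *v (matrix_inv A *v x) = x" "matrix_inv A *v (A *v x) = x"
    by (simp_all add: matrix_vector_mul_assoc)
qed

lemma pos_def_invertible: "pos_def A \<Longrightarrow> invertible A"
  by (subst invertible_iff_ker) (metis inner_zero_right less_irrefl pos_def_pos)

lemma transpose_block_diag: "transpose (block_diag A B) = block_diag (transpose A) (transpose B)"
  by (auto simp: vec_eq_iff transpose_def block_diag_def sym_block_def vcat_def hcat_def vjoin_def split: sum.splits)

lemma block_diag_eq_iff: "block_diag A B = block_diag A' B' \<longleftrightarrow> A = A' \<and> B = B'"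
proof
  assume eq: "block_diag A B = block_diag A' B'"
  have "vjoin (A *v x) (B *v y) = vjoin (A' *v x) (B' *v y)" for x y
    using eq by (metis block_diag_mult_vjoin)
  then show "A = A' \<and> B = B'" by (simp add: vjoin_eq_iff matrix_eq)
qed simp

lemma pos_def_block_diag: "pos_def (block_diag A B) \<Longrightarrow> pos_def A \<and> pos_def B"
  unfolding pos_def_def transpose_block_diag block_diag_eq_iff
  by (metis add.right_neutral add.left_neutral block_diag_mult_vjoin inner_vjoin inner_zero_left vjoin_eq_iff vjoin_zero)

lemma pos_semidef_block_diag: "pos_semidef (block_diag A B) \<Longrightarrow> pos_semidef A \<and> pos_semidef B"
  unfolding pos_semidef_def transpose_block_diag block_diag_eq_iff
  by (metis add.right_neutral add.left_neutral block_diag_mult_vjoin inner_vjoin inner_zero_left)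

lemma mat_le_form: "A \<preceq>\<^sub>m B \<Longrightarrow> x \<bullet> (A *v x) \<le> x \<bullet> (B *v x)"
  by (simp add: mat_le_def pos_semidef_def matrix_vector_mult_diff_rdistrib inner_diff_right)

lemma mat_le_block_diag:
  assumes "block_diag A B \<preceq>\<^sub>m \<mu> *\<^sub>R block_diag A' B'"
  shows "A \<preceq>\<^sub>m \<mu> *\<^sub>R A'" "B \<preceq>\<^sub>m \<mu> *\<^sub>R B'"
proof -
  have "\<mu> *\<^sub>R block_diag A' B' - block_diag A B = block_diag (\<mu> *\<^sub>R A' - A) (\<mu> *\<^sub>R B' - B)"
    by (auto simp: vec_eq_iff block_diag_def sym_block_def vcat_def hcat_def vjoin_def transpose_def split: sum.splits)
  then show "A \<preceq>\<^sub>m \<mu> *\<^sub>R A'" "B \<preceq>\<^sub>m \<mu> *\<^sub>R B'"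
    using assms pos_semidef_block_diag unfolding mat_le_def by metis+
qed

section \<open>The delay functional of a sequence\<close>

definition window_sum :: "real \<Rightarrow> nat \<Rightarrow> (int \<Rightarrow> real) \<Rightarrow> int \<Rightarrow> real" where
  "window_sum \<alpha> n g i = (\<Sum>r<n. \<alpha> ^ r * g (i - 1 - int r))"

text \<open>
  The reason for the geometric weights: shifting the window multiplies the sum by \<open>\<alpha>\<close> exactly,
  except for one term that enters and one that leaves.
\<close>

lemma window_sum_step: "window_sum \<alpha> n g (i + 1) = g i + \<alpha> * window_sum \<alpha> n g i - \<alpha> ^ n * g (i - int n)"
proof -
  have "window_sum \<alpha> (Suc n) g (i + 1) = g i + \<alpha> * window_sum \<alpha> n g i"
    unfolding window_sum_def sum.lessThan_Suc_shift
    by (simp add: sum_distrib_left algebra_simps)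
  moreover have "window_sum \<alpha> (Suc n) g (i + 1) = window_sum \<alpha> n g (i + 1) + \<alpha> ^ n * g (i - int n)"
    by (simp add: window_sum_def)
  ultimately show ?thesis by simp
qed

lemma window_sum_mono: "0 \<le> \<alpha> \<Longrightarrow> (\<And>r. g r \<le> \<mu> * g' r) \<Longrightarrow> window_sum \<alpha> n g i \<le> \<mu> * window_sum \<alpha> n g' i"
  unfolding window_sum_def sum_distrib_left
  by (intro sum_mono) (metis mult.left_commute mult_left_mono zero_le_power)

lemma window_sum_nonneg: "0 \<le> \<alpha> \<Longrightarrow> (\<And>r. 0 \<le> g r) \<Longrightarrow> 0 \<le> window_sum \<alpha> n g i"
  unfolding window_sum_def by (intro sum_nonneg mult_nonneg_nonneg) auto

text \<open>
  The forms \<open>p, q1, q2, w1, w2\<close> are arbitrary real functions: what matters about them are sign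
  conditions and pointwise inequalities. The nested sums cover the increments with weights such that a shift
  produces \<open>l\<close> and \<open>H - l\<close> fresh copies of the current increment.
\<close>

definition delay_functional where
  "delay_functional \<alpha> l H p q1 q2 w1 w2 (f :: int \<Rightarrow> 'a::real_vector) i =
     p (f i) + window_sum \<alpha> l (\<lambda>r. q1 (f r)) i + window_sum \<alpha> H (\<lambda>r. q2 (f r)) i
     + (\<Sum>s\<in>{0<..l}. window_sum \<alpha> s (\<lambda>r. w1 (f (r + 1) - f r)) i)
     + (\<Sum>s\<in>{l<..H}. window_sum \<alpha> s (\<lambda>r. w2 (f (r + 1) - f r)) i)"

text \<open>
  The leaving terms carry the weights \<open>\<alpha> ^ s\<close> for \<open>s \<le> b\<close>; replacing each by the smallest one, \<open>\<alpha> ^ b\<close>,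
  produces the constant factors \<open>\<Lambda>\<^sub>3\<close> and \<open>\<Lambda>\<^sub>4\<close> of the matrix inequality.
\<close>

lemma nested_window_step:
  fixes g :: "int \<Rightarrow> real"
  assumes "0 < \<alpha>" "\<alpha> \<le> 1" "\<And>r. 0 \<le> g r"  "a \<le> b"
  shows "(\<Sum>s\<in>{a<..b}. window_sum \<alpha> s g (i + 1)) - \<alpha> * (\<Sum>s\<in>{a<..b}. window_sum \<alpha> s g i)
    \<le> (real b - real a) * g i - \<alpha> ^ b * (\<Sum>s\<in>{a<..b}. g (i - int s))"
proof -
  have "(\<Sum>s\<in>{a<..b}. window_sum \<alpha> s g (i + 1)) - \<alpha> * (\<Sum>s\<in>{a<..b}. window_sum \<alpha> s g i)
     = (\<Sum>s\<in>{a<..b}. g i - \<alpha> ^ s * g (i - int s))"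
    by (simp add: window_sum_step sum_distrib_left sum.distrib sum_subtractf)
  also have "\<dots> \<le> (\<Sum>s\<in>{a<..b}. g i - \<alpha> ^ b * g (i - int s))"
    using assms by (intro sum_mono diff_left_mono mult_right_mono power_decreasing) auto
  also have "\<dots> = (real b - real a) * g i - \<alpha> ^ b * (\<Sum>s\<in>{a<..b}. g (i - int s))"
    using assms by (simp add: sum_subtractf sum_distrib_left of_nat_diff)
  finally show ?thesis .
qed

lemma telescope_window:
  fixes g :: "int \<Rightarrow> 'a::ab_group_add"
  assumes "a \<le> b"
  shows "(\<Sum>s\<in>{a<..b}. g (i - int s + 1) - g (i - int s)) = g (i - int a) - g (i - int b)"
  using assms
proof (induction b rule: dec_induct)
  case (step n)
  have "{a<..Suc n} = insert (Suc n) {a<..n}" using step by auto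
  then show ?case using step by simp
qed simp

text \<open>
  The free-weighting device: an inequality for a single increment, linear in the increment except for
  its form \<open>w\<close>, is summed over a window, where the linear part telescopes to the endpoints.
\<close>

lemma window_bound:
  fixes f :: "int \<Rightarrow> 'a::real_vector"
  assumes "linear m" "\<And>e. 0 \<le> x + 2 * m e + w e" "a \<le> b"
  shows "0 \<le> (real b - real a) * x + 2 * m (f (i - int a) - f (i - int b))
    + (\<Sum>s\<in>{a<..b}. w (f (i - int s + 1) - f (i - int s)))"
proof -
  have "0 \<le> (\<Sum>s\<in>{a<..b}. x + 2 * m (f (i - int s + 1) - f (i - int s)) + w (f (i - int s + 1) - f (i - int s)))"
    using assms by (intro sum_nonneg) auto
  also have "\<dots> = (real b - real a) * x + 2 * m (\<Sum>s\<in>{a<..b}. f (i - int s + 1) - f (i - int s))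
    + (\<Sum>s\<in>{a<..b}. w (f (i - int s + 1) - f (i - int s)))"
    using assms by (simp add: sum.distrib sum_distrib_left linear_sum of_nat_diff)
  finally show ?thesis by (simp only: telescope_window[OF assms(3)])
qed

text \<open>
  The window \<open>{l<..H}\<close> is cut at the actual delay \<open>d\<close>, so that \<open>f (i - d)\<close>, which drives the
  system, appears as an endpoint of both halves. The two halves have the same constant \<open>y\<close> but different
  linear parts \<open>s\<close> and \<open>n\<close>; thus the multiple \<open>(H - l) y\<close> does not depend on \<open>d\<close>.
\<close>

lemma delay_functional_step:
  fixes f :: "int \<Rightarrow> 'a::real_vector"
  assumes "0 < \<alpha>" "\<alpha> \<le> 1" "l \<le> d" "d \<le> H"
    and w: "\<And>e. 0 \<le> w1 e" "\<And>e. 0 \<le> w2 e"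
    and lin: "linear m" "linear n" "linear s"
    and slack: "\<And>e. 0 \<le> x + 2 * m e + w1 e" "\<And>e. 0 \<le> y + 2 * n e + w2 e" "\<And>e. 0 \<le> y + 2 * s e + w2 e"
  shows "delay_functional \<alpha> l H p q1 q2 w1 w2 f (i + 1) - \<alpha> * delay_functional \<alpha> l H p q1 q2 w1 w2 f i \<le>
     p (f (i + 1)) + real l * w1 (f (i + 1) - f i) + (real H - real l) * w2 (f (i + 1) - f i)
     - \<alpha> * p (f i) + q1 (f i) + q2 (f i) - \<alpha> ^ l * q1 (f (i - int l)) - \<alpha> ^ H * q2 (f (i - int H))
     + \<alpha> ^ l * (real l * x + 2 * m (f i - f (i - int l)))
     + \<alpha> ^ H * ((real H - real l) * y + 2 * s (f (i - int l) - f (i - int d))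
                + 2 * n (f (i - int d) - f (i - int H)))"
proof -
  define g1 where "g1 r = w1 (f (r + 1) - f r)" for r
  define g2 where "g2 r = w2 (f (r + 1) - f r)" for r
  have step: "delay_functional \<alpha> l H p q1 q2 w1 w2 f (i + 1) - \<alpha> * delay_functional \<alpha> l H p q1 q2 w1 w2 f i
     = p (f (i + 1)) - \<alpha> * p (f i) + q1 (f i) + q2 (f i) - \<alpha> ^ l * q1 (f (i - int l)) - \<alpha> ^ H * q2 (f (i - int H))
      + ((\<Sum>s\<in>{0<..l}. window_sum \<alpha> s g1 (i + 1)) - \<alpha> * (\<Sum>s\<in>{0<..l}. window_sum \<alpha> s g1 i))
      + ((\<Sum>s\<in>{l<..H}. window_sum \<alpha> s g2 (i + 1)) - \<alpha> * (\<Sum>s\<in>{l<..H}. window_sum \<alpha> s g2 i))"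
    unfolding delay_functional_def g1_def[symmetric] g2_def[symmetric]
    by (simp only: window_sum_step[of \<alpha> l] window_sum_step[of \<alpha> H]) (simp add: algebra_simps)
  have A: "(\<Sum>s\<in>{0<..l}. window_sum \<alpha> s g1 (i + 1)) - \<alpha> * (\<Sum>s\<in>{0<..l}. window_sum \<alpha> s g1 i)
     \<le> (real l - real 0) * g1 i - \<alpha> ^ l * (\<Sum>s\<in>{0<..l}. g1 (i - int s))"
    using assms by (intro nested_window_step) (auto simp: g1_def)
  have B: "(\<Sum>s\<in>{l<..H}. window_sum \<alpha> s g2 (i + 1)) - \<alpha> * (\<Sum>s\<in>{l<..H}. window_sum \<alpha> s g2 i)
     \<le> (real H - real l) * g2 i - \<alpha> ^ H * (\<Sum>s\<in>{l<..H}. g2 (i - int s))"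
    using assms by (intro nested_window_step) (auto simp: g2_def)
  have "{l<..H} = {l<..d} \<union> {d<..H}" using assms by auto
  then have C: "(\<Sum>s\<in>{l<..H}. g2 (i - int s)) = (\<Sum>s\<in>{l<..d}. g2 (i - int s)) + (\<Sum>s\<in>{d<..H}. g2 (i - int s))"
    by (simp only:) (rule sum.union_disjoint; auto)
  have "0 \<le> (real l - real 0) * x + 2 * m (f (i - int 0) - f (i - int l)) + (\<Sum>s\<in>{0<..l}. g1 (i - int s))"
    unfolding g1_def using lin slack by (intro window_bound) auto
  then have "0 \<le> \<alpha> ^ l * ((real l - real 0) * x + 2 * m (f (i - int 0) - f (i - int l)) + (\<Sum>s\<in>{0<..l}. g1 (i - int s)))"
    using \<open>0 < \<alpha>\<close> by simp
  moreover have S: "0 \<le> (real d - real l) * y + 2 * s (f (i - int l) - f (i - int d)) + (\<Sum>s\<in>{l<..d}. g2 (i - int s))"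
    unfolding g2_def using lin slack \<open>l \<le> d\<close> by (intro window_bound) auto
  have N: "0 \<le> (real H - real d) * y + 2 * n (f (i - int d) - f (i - int H)) + (\<Sum>s\<in>{d<..H}. g2 (i - int s))"
    unfolding g2_def using lin slack \<open>d \<le> H\<close> by (intro window_bound) auto
  have "0 \<le> \<alpha> ^ H * (((real d - real l) * y + 2 * s (f (i - int l) - f (i - int d)) + (\<Sum>s\<in>{l<..d}. g2 (i - int s)))
      + ((real H - real d) * y + 2 * n (f (i - int d) - f (i - int H)) + (\<Sum>s\<in>{d<..H}. g2 (i - int s))))"
    using \<open>0 < \<alpha>\<close> add_nonneg_nonneg[OF S N] by (intro mult_nonneg_nonneg) auto
  ultimately show ?thesis
    using A B unfolding step C g1_def[of i] g2_def[of i] by (simp add: algebra_simps)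
qed

lemma delay_functional_mono:
  assumes "0 \<le> \<alpha>" "\<And>x. p x \<le> \<mu> * p' x" "\<And>x. q1 x \<le> \<mu> * q1' x" "\<And>x. q2 x \<le> \<mu> * q2' x"
    "\<And>x. w1 x \<le> \<mu> * w1' x" "\<And>x. w2 x \<le> \<mu> * w2' x"
  shows "delay_functional \<alpha> l H p q1 q2 w1 w2 f i \<le> \<mu> * delay_functional \<alpha> l H p' q1' q2' w1' w2' f i"
  unfolding delay_functional_def distrib_left sum_distrib_left
  using assms by (intro add_mono sum_mono window_sum_mono) auto

lemma delay_functional_ge:
  assumes "0 \<le> \<alpha>" "\<And>x. 0 \<le> q1 x" "\<And>x. 0 \<le> q2 x" "\<And>x. 0 \<le> w1 x" "\<And>x. 0 \<le> w2 x"
  shows "p (f i) \<le> delay_functional \<alpha> l H p q1 q2 w1 w2 f i"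
proof -
  have "0 \<le> window_sum \<alpha> l (\<lambda>r. q1 (f r)) i" "0 \<le> window_sum \<alpha> H (\<lambda>r. q2 (f r)) i"
     "0 \<le> (\<Sum>s\<in>{0<..l}. window_sum \<alpha> s (\<lambda>r. w1 (f (r + 1) - f r)) i)"
     "0 \<le> (\<Sum>s\<in>{l<..H}. window_sum \<alpha> s (\<lambda>r. w2 (f (r + 1) - f r)) i)"
    using assms by (auto intro!: window_sum_nonneg sum_nonneg)
  then show ?thesis unfolding delay_functional_def by linarith
qed

lemma norm_diff_sq_le: "(norm (x - y))\<^sup>2 \<le> 2 * (norm x)\<^sup>2 + 2 * (norm (y :: 'a::real_inner))\<^sup>2"
  using zero_le_power2[of "norm (x + y)"] by (simp add: power2_norm_eq_inner inner_add inner_diff)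

lemma window_sum_le:
  assumes "0 \<le> \<alpha>" "\<alpha> \<le> 1" "\<And>r. 0 \<le> g r" "n \<le> m"
  shows "window_sum \<alpha> n g i \<le> (\<Sum>r<m. g (i - 1 - int r))"
proof -
  have "window_sum \<alpha> n g i \<le> (\<Sum>r<n. g (i - 1 - int r))"
    unfolding window_sum_def using assms by (intro sum_mono mult_left_le_one_le power_le_one) auto
  also have "\<dots> \<le> (\<Sum>r<m. g (i - 1 - int r))"
    using assms by (intro sum_mono2) auto
  finally show ?thesis .
qed

lemma delay_functional_le:
  fixes f :: "int \<Rightarrow> 'a::real_inner"
  assumes \<alpha>: "0 \<le> \<alpha>" "\<alpha> \<le> 1" and "l \<le> H" "0 \<le> c"
    and nn: "\<And>x. 0 \<le> q1 x" "\<And>x. 0 \<le> q2 x" "\<And>x. 0 \<le> w1 x" "\<And>x. 0 \<le> w2 x"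
    and c: "\<And>x. p x \<le> c * (norm x)\<^sup>2" "\<And>x. q1 x \<le> c * (norm x)\<^sup>2" "\<And>x. q2 x \<le> c * (norm x)\<^sup>2"
      "\<And>x. w1 x \<le> c * (norm x)\<^sup>2" "\<And>x. w2 x \<le> c * (norm x)\<^sup>2"
  shows "delay_functional \<alpha> l H p q1 q2 w1 w2 f i \<le> c * (3 + 4 * real H) * (\<Sum>r\<le>H. (norm (f (i - int r)))\<^sup>2)"
proof -
  define B where "B = c * (\<Sum>r\<le>H. (norm (f (i - int r)))\<^sup>2)"
  have head: "c * (\<Sum>r<H. (norm (f (i - int r)))\<^sup>2) \<le> B"
    unfolding B_def using assms by (intro mult_left_mono sum_mono2) auto
  have "(\<Sum>r<H. (norm (f (i - 1 - int r)))\<^sup>2) \<le> (\<Sum>r\<le>H. (norm (f (i - int r)))\<^sup>2)"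
    unfolding lessThan_Suc_atMost[symmetric] sum.lessThan_Suc_shift by (simp add: algebra_simps)
  then have tail: "c * (\<Sum>r<H. (norm (f (i - 1 - int r)))\<^sup>2) \<le> B"
    unfolding B_def using assms by (intro mult_left_mono) auto
  have q: "window_sum \<alpha> n (\<lambda>r. q (f r)) i \<le> B" if "\<And>x. 0 \<le> q x" "\<And>x. q x \<le> c * (norm x)\<^sup>2" "n \<le> H" for q n
  proof -
    have "window_sum \<alpha> n (\<lambda>r. q (f r)) i \<le> (\<Sum>r<H. q (f (i - 1 - int r)))"
      using that \<alpha> by (intro window_sum_le) auto
    also have "\<dots> \<le> c * (\<Sum>r<H. (norm (f (i - 1 - int r)))\<^sup>2)"
      unfolding sum_distrib_left by (intro sum_mono that)
    finally show ?thesis using tail by linarith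
  qed
  have w: "window_sum \<alpha> n (\<lambda>r. w (f (r + 1) - f r)) i \<le> 4 * B" if "\<And>x. 0 \<le> w x" "\<And>x. w x \<le> c * (norm x)\<^sup>2" "n \<le> H" for w n
  proof -
    have "window_sum \<alpha> n (\<lambda>r. w (f (r + 1) - f r)) i \<le> (\<Sum>r<H. w (f (i - 1 - int r + 1) - f (i - 1 - int r)))"
      using that \<alpha> by (intro window_sum_le) auto
    also have "\<dots> \<le> (\<Sum>r<H. c * (2 * (norm (f (i - int r)))\<^sup>2 + 2 * (norm (f (i - 1 - int r)))\<^sup>2))"
    proof (intro sum_mono)
      fix r
      have "w (f (i - int r) - f (i - 1 - int r)) \<le> c * (norm (f (i - int r) - f (i - 1 - int r)))\<^sup>2"
        by (rule that)
      also have "\<dots> \<le> c * (2 * (norm (f (i - int r)))\<^sup>2 + 2 * (norm (f (i - 1 - int r)))\<^sup>2)"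
        by (intro mult_left_mono norm_diff_sq_le assms)
      finally show "w (f (i - 1 - int r + 1) - f (i - 1 - int r))
         \<le> c * (2 * (norm (f (i - int r)))\<^sup>2 + 2 * (norm (f (i - 1 - int r)))\<^sup>2)" by simp
    qed
    also have "\<dots> = 2 * (c * (\<Sum>r<H. (norm (f (i - int r)))\<^sup>2)) + 2 * (c * (\<Sum>r<H. (norm (f (i - 1 - int r)))\<^sup>2))"
      by (simp add: sum_distrib_left sum.distrib algebra_simps)
    finally show ?thesis using head tail by linarith
  qed
  have "(norm (f i))\<^sup>2 \<le> (\<Sum>r\<le>H. (norm (f (i - int r)))\<^sup>2)"
    using member_le_sum[of 0 "{..H}" "\<lambda>r. (norm (f (i - int r)))\<^sup>2"] by auto
  then have p: "p (f i) \<le> B"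
    unfolding B_def using c(1)[of "f i"] \<open>0 \<le> c\<close> by (meson mult_left_mono order_trans)
  have w1: "(\<Sum>s\<in>{0<..l}. window_sum \<alpha> s (\<lambda>r. w1 (f (r + 1) - f r)) i) \<le> (\<Sum>s\<in>{0<..l}. 4 * B)"
    using \<open>l \<le> H\<close> by (intro sum_mono w nn c) auto
  have w2: "(\<Sum>s\<in>{l<..H}. window_sum \<alpha> s (\<lambda>r. w2 (f (r + 1) - f r)) i) \<le> (\<Sum>s\<in>{l<..H}. 4 * B)"
    using \<open>l \<le> H\<close> by (intro sum_mono w nn c) auto
  have "delay_functional \<alpha> l H p q1 q2 w1 w2 f i \<le> B + B + B + real l * (4 * B) + (real H - real l) * (4 * B)"
    unfolding delay_functional_def using p q[OF nn(1) c(2), of l] q[OF nn(2) c(3), of H] w1 w2 \<open>l \<le> H\<close>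
    by (simp add: of_nat_diff)
  then show ?thesis unfolding B_def by (simp add: algebra_simps)
qed

section \<open>The quadratic form of the matrix inequality\<close>

text \<open>
  The contribution of one direction to the block \<open>\<Phi>\<^sub>1\<close>, sorted by the origin of its terms in
  \<open>delay_functional_step\<close>. The arguments stand for the current state and for the states
  delayed by \<open>d\<close>, \<open>l\<close> and \<open>H\<close>, in this order, each multiplied by the inverse of \<open>Z\<close>.
\<close>

definition delay_form where
  "delay_form \<alpha> l H V a b c d =
     a \<bullet> (Q1b V *v a) + a \<bullet> (Q2b V *v a) - \<alpha> * (a \<bullet> (Pb V *v a))
     - \<alpha> ^ l * (c \<bullet> (Q1b V *v c)) - \<alpha> ^ H * (d \<bullet> (Q2b V *v d))
     + \<alpha> ^ l * (real l * (a \<bullet> (X11b V *v a) + 2 * (a \<bullet> (X12b V *v b)) + b \<bullet> (X22b V *v b))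
              + 2 * (a \<bullet> (M1b V *v (a - c)) + b \<bullet> (M2b V *v (a - c))))
     + \<alpha> ^ H * ((real H - real l) * (a \<bullet> (Y11b V *v a) + 2 * (a \<bullet> (Y12b V *v b)) + b \<bullet> (Y22b V *v b))
              + 2 * (a \<bullet> (S1b V *v (c - b)) + b \<bullet> (S2b V *v (c - b)))
              + 2 * (a \<bullet> (N1b V *v (b - d)) + b \<bullet> (N2b V *v (b - d))))"

lemma matrix_vector_minus_left: "(- A) *v x = - (A *v (x :: real^'n))"
  by (simp add: matrix_vector_mult_def vec_eq_iff sum_negf)

lemma block_diag_mult: "block_diag A B ** block_diag A' B' = block_diag (A ** A') (B ** B')"
proof -
  have "(block_diag A B ** block_diag A' B') *v w = block_diag (A ** A') (B ** B') *v w" for w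
    by (cases w rule: vjoin_cases) (simp add: matrix_vector_mul_assoc[symmetric] block_diag_mult_vjoin)
  then show ?thesis by (simp add: matrix_eq)
qed

lemma block_diag_mat_1: "block_diag (mat 1) (mat 1) = mat 1"
proof -
  have "block_diag (mat 1) (mat 1) *v w = mat 1 *v w" for w :: "real^('a+'b)"
    by (cases w rule: vjoin_cases) (simp add: block_diag_mult_vjoin)
  then show ?thesis by (simp add: matrix_eq)
qed

lemma matrix_inv_eqI:
  assumes "A ** B = mat 1" "B ** (A :: real^'n::finite^'n) = mat 1"
  shows "matrix_inv A = B"
proof -
  have "invertible A" using assms by (auto simp: invertible_def)
  then have "matrix_inv A *v (A *v (B *v x)) = B *v x" for x by (rule matrix_inv_mult)
  then have "matrix_inv A *v x = B *v x" for x
    using assms by (simp add: matrix_vector_mul_assoc)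
  then show ?thesis by (simp add: matrix_eq)
qed

lemma mat_mult_mat: "(mat a :: real^'n::finite^'n) ** mat b = mat (a * b)"
proof -
  have "((mat a :: real^'n::finite^'n) ** mat b) *v x = mat (a * b) *v x" for x
    by (simp add: matrix_vector_mul_assoc[symmetric] mat_mult_vec)
  then show ?thesis by (simp add: matrix_eq)
qed

lemma matrix_inv_scalar_blocks:
  assumes "a \<noteq> 0" "b \<noteq> 0"
  shows "matrix_inv (block_diag (mat a) (mat b)) = block_diag (mat (1 / a)) (mat (1 / b))"
  using assms by (intro matrix_inv_eqI) (simp_all add: block_diag_mult mat_mult_mat block_diag_mat_1)

lemma inner_mult_left: "x \<bullet> (A *v y) = (transpose A *v x) \<bullet> (y :: real^'n)"
  using inner_transpose[of y A x] by (simp add: inner_commute)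

lemma diag_mat_mult: "diag_mat d *v x = (\<chi> i. d i * x $ i)"
  by (simp add: vec_eq_iff diag_mat_def matrix_vector_mult_def if_distrib if_distribR cong: if_cong)

lemma diag_mat_form: "x \<bullet> (diag_mat d *v y) = (\<Sum>i\<in>UNIV. d i * (x $ i * y $ i))"
  by (simp add: diag_mat_mult inner_vec_def algebra_simps)

text \<open>
  Since \<open>\<Phi>\<^sub>6\<close> occurs in all positions of the three middle block rows, its total contribution is its
  quadratic form at the sum \<open>r\<close> of the three middle blocks. The last two summands group the terms
  that compensate the parameter uncertainty and the actuator faults.
\<close>

lemma Phi_bar_form:
  fixes S :: "('h::finite, 'v::finite, 'u::finite, 'p::finite, 'q::finite) subsystem"
    and a1 b1 c1 d1 e1 f1 g1 :: "real^'h" and a2 b2 c2 d2 e2 f2 g2 :: "real^'v"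
    and Zh :: "('h, 'h) rmat" and Zv :: "('v, 'v) rmat" and \<Upsilon> :: "('u, 'h + 'v) rmat" and s :: "real^'q" and t :: "real^'u"
    and \<omega>L \<omega>H :: "'u \<Rightarrow> real"
  assumes "0 < dhL" "dhL < dhH" "0 < dvL" "dvL < dvH"
  defines "\<zeta> \<equiv> vjoin (vjoin a1 a2) (vjoin (vjoin b1 b2) (vjoin (vjoin c1 c2) (vjoin d1 d2)))"
    and "Z \<equiv> block_diag Zh Zv"
  defines "r \<equiv> vjoin (e1 + f1 + g1) (e2 + f2 + g2)"
    and "R \<equiv> A_mat S *v (Z *v vjoin a1 a2) + B_mat S *v (Omega0 \<omega>L \<omega>H *v (\<Upsilon> *v vjoin a1 a2))
             + Ad_mat S *v (Z *v vjoin b1 b2)"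
    and "w \<equiv> vjoin \<zeta> (vjoin (vjoin e1 e2) (vjoin (vjoin f1 f2) (vjoin (vjoin g1 g2) (vjoin s t))))"
  shows "w \<bullet> (Phi_bar \<alpha> dhL dhH dvL dvH \<delta> \<epsilon> S \<omega>L \<omega>H Vh Vv Z \<Upsilon> *v w) =
     delay_form \<alpha> dhL dhH Vh a1 b1 c1 d1 + delay_form \<alpha> dvL dvH Vv a2 b2 c2 d2
     + 2 * (vjoin (e1 + f1) (e2 + f2) \<bullet> (R - Z *v vjoin a1 a2)) + 2 * (vjoin g1 g2 \<bullet> R)
     - (1 / real dhL * (e1 \<bullet> (W1b Vh *v e1)) + 1 / real dvL * (e2 \<bullet> (W1b Vv *v e2)))
     - (1 / (real dhH - real dhL) * (f1 \<bullet> (W2b Vh *v f1)) + 1 / (real dvH - real dvL) * (f2 \<bullet> (W2b Vv *v f2)))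
     + (g1 \<bullet> (Pb Vh *v g1) - 2 * (g1 \<bullet> (Zh *v g1))) + (g2 \<bullet> (Pb Vv *v g2) - 2 * (g2 \<bullet> (Zv *v g2)))
     + (\<delta> * ((transpose (H_mat S) *v r) \<bullet> (transpose (H_mat S) *v r))
        + 2 * (s \<bullet> (E_mat S *v (Z *v vjoin a1 a2) + Ed_mat S *v (Z *v vjoin b1 b2))) - \<delta> * (s \<bullet> s))
     + (\<epsilon> * ((transpose (Omega0 \<omega>L \<omega>H) *v (transpose (B_mat S) *v r)) \<bullet>
              (Xi \<omega>L \<omega>H *v (transpose (Omega0 \<omega>L \<omega>H) *v (transpose (B_mat S) *v r))))
        + 2 * (t \<bullet> (Xi \<omega>L \<omega>H *v (\<Upsilon> *v vjoin a1 a2))) - \<epsilon> * (t \<bullet> (Xi \<omega>L \<omega>H *v t)))"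
proof -
  define \<Phi>6 where "\<Phi>6 = \<delta> *\<^sub>R (H_mat S ** transpose (H_mat S))
           + \<epsilon> *\<^sub>R (B_mat S ** Omega0 \<omega>L \<omega>H ** Xi \<omega>L \<omega>H ** transpose (Omega0 \<omega>L \<omega>H) ** transpose (B_mat S))"
  have \<Phi>6: "x \<bullet> (\<Phi>6 *v y) = \<delta> * ((transpose (H_mat S) *v x) \<bullet> (transpose (H_mat S) *v y))
     + \<epsilon> * ((transpose (Omega0 \<omega>L \<omega>H) *v (transpose (B_mat S) *v x)) \<bullet>
              (Xi \<omega>L \<omega>H *v (transpose (Omega0 \<omega>L \<omega>H) *v (transpose (B_mat S) *v y))))" for x y
    unfolding \<Phi>6_def
    by (simp only: matrix_vector_mult_add_rdistrib inner_add_right scaleR_matrix_vector_assoc[symmetric]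
      inner_scaleR_right matrix_vector_mul_assoc[symmetric] inner_mult_left[of _ "H_mat S"]
      inner_mult_left[of _ "B_mat S"] inner_mult_left[of _ "Omega0 \<omega>L \<omega>H"])
  have sym: "y \<bullet> (\<Phi>6 *v x) = x \<bullet> (\<Phi>6 *v y)" for x y
    unfolding \<Phi>6 Xi_def diag_mat_form by (simp add: inner_commute mult.commute)
  have r: "r = vjoin e1 e2 + vjoin f1 f2 + vjoin g1 g2" by (simp add: r_def vjoin_add)
  have inv: "matrix_inv (block_diag (mat (real dhL)) (mat (real dvL))) = block_diag (mat (1 / real dhL)) (mat (1 / real dvL))"
    "matrix_inv (block_diag (mat (real dhH - real dhL)) (mat (real dvH - real dvL)))
      = block_diag (mat (1 / (real dhH - real dhL))) (mat (1 / (real dvH - real dvL)))"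
    using assms by (auto intro!: matrix_inv_scalar_blocks)
  have rr: "\<delta> * ((transpose (H_mat S) *v r) \<bullet> (transpose (H_mat S) *v r))
    + \<epsilon> * ((transpose (Omega0 \<omega>L \<omega>H) *v (transpose (B_mat S) *v r)) \<bullet>
              (Xi \<omega>L \<omega>H *v (transpose (Omega0 \<omega>L \<omega>H) *v (transpose (B_mat S) *v r))))
    = vjoin e1 e2 \<bullet> (\<Phi>6 *v vjoin e1 e2) + vjoin f1 f2 \<bullet> (\<Phi>6 *v vjoin f1 f2) + vjoin g1 g2 \<bullet> (\<Phi>6 *v vjoin g1 g2)
    + 2 * (vjoin e1 e2 \<bullet> (\<Phi>6 *v vjoin f1 f2)) + 2 * (vjoin e1 e2 \<bullet> (\<Phi>6 *v vjoin g1 g2)) + 2 * (vjoin f1 f2 \<bullet> (\<Phi>6 *v vjoin g1 g2))"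
    unfolding \<Phi>6[symmetric] r
    by (simp add: matrix_vector_right_distrib inner_add sym[of "vjoin f1 f2" "vjoin e1 e2"]
        sym[of "vjoin g1 g2" "vjoin e1 e2"] sym[of "vjoin g1 g2" "vjoin f1 f2"])
  show ?thesis
    unfolding w_def \<zeta>_def Phi_bar_def Let_def \<Phi>6_def[symmetric] Z_def inv delay_form_def R_def
    apply (simp only: sym_block_form hcat_mult_vjoin inner_add_right inner_transpose
       matrix_vector_mult_0_right matrix_vector_mult_add_rdistrib matrix_vector_mult_diff_rdistrib
       matrix_vector_minus_left scaleR_matrix_vector_assoc[symmetric] transpose_block_diag
       matrix_vector_mul_assoc[symmetric] block_diag_mult_vjoin mat_mult_vec matrix_vector_mult_0
       matrix_vector_right_distrib matrix_vector_mult_diff_distrib inner_diff_right inner_minus_right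
       inner_scaleR_right inner_zero_right inner_vjoin vjoin_scaleR vjoin_add[symmetric] inner_add_left)
    using rr
    unfolding inner_transpose[of "transpose (H_mat S) *v r"] by (simp add: algebra_simps)
qed

section \<open>Eliminating the auxiliary vectors\<close>

definition inv_form :: "real^'n^'n \<Rightarrow> real^'n::finite \<Rightarrow> real" where
  "inv_form W x = x \<bullet> (matrix_inv W *v x)"

text \<open>
  The form of \<open>Z\<^sup>-\<^sup>T A Z\<^sup>-\<^sup>1\<close>, which is the unbarred matrix that belongs to the barred matrix \<open>A\<close>.
\<close>

definition pulled_form :: "real^'n^'n \<Rightarrow> real^'n^'n \<Rightarrow> real^'n::finite \<Rightarrow> real" where
  "pulled_form Z A x = (matrix_inv Z *v x) \<bullet> (A *v (matrix_inv Z *v x))"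

lemma inv_form_nonneg: "pos_def W \<Longrightarrow> 0 \<le> inv_form W x"
  unfolding inv_form_def
  by (metis inner_commute matrix_inv_mult(1) pos_def_invertible pos_def_nonneg)

text \<open>
  The form of the inverse is the convex conjugate of the form of \<open>W\<close>; this duality replaces both
  congruence and Schur complement.
\<close>

lemma inv_form_ge:
  assumes "pos_def W"
  shows "2 * (x \<bullet> y) - y \<bullet> (W *v y) \<le> inv_form W x"
proof -
  define v where "v = matrix_inv W *v x"
  have x: "x = W *v v" using assms by (simp add: v_def matrix_inv_mult pos_def_invertible)
  have "0 \<le> (v - y) \<bullet> (W *v (v - y))" by (rule pos_def_nonneg[OF assms])
  then show ?thesis
    unfolding inv_form_def v_def[symmetric]
    using pos_def_symm[OF assms, of v y]
    by (simp add: x inner_diff matrix_vector_mult_diff_distrib inner_commute)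
qed

lemma inv_form_attained:
  fixes x :: "real^'d::finite"
  assumes "pos_def W" "c \<noteq> 0"
  defines "y \<equiv> c *\<^sub>R (matrix_inv W *v x)"
  shows "2 * (y \<bullet> x) - 1 / c * (y \<bullet> (W *v y)) = c * inv_form W x"
  using assms
  by (simp add: inv_form_def matrix_vector_mult_scaleR matrix_inv_mult pos_def_invertible inner_commute)

text \<open>
  With \<open>v\<close> such that \<open>W v = x\<close>, the conjugate of \<open>W'\<close> is tested at \<open>v / \<mu>\<close>, the point that balances the
  linear and the quadratic term.
\<close>

lemma inv_form_antimono:
  assumes W: "pos_def W" and W': "pos_def W'" and "0 < \<mu>" and le: "W' \<preceq>\<^sub>m \<mu> *\<^sub>R W"
  shows "inv_form W x \<le> \<mu> * inv_form W' x"
proof -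
  define v where "v = matrix_inv W *v x"
  have x: "W *v v = x" using W by (simp add: v_def matrix_inv_mult pos_def_invertible)
  define c where "c = 1 / \<mu>"
  have c: "c * c * \<mu> = c" using \<open>0 < \<mu>\<close> by (simp add: c_def)
  have "2 * (x \<bullet> (c *\<^sub>R v)) - (c *\<^sub>R v) \<bullet> (W' *v (c *\<^sub>R v)) \<le> inv_form W' x"
    by (rule inv_form_ge[OF W'])
  then have "2 * (c * (v \<bullet> x)) - c * c * (v \<bullet> (W' *v v)) \<le> inv_form W' x"
    by (simp add: matrix_vector_mult_scaleR inner_commute)
  moreover have "v \<bullet> (W' *v v) \<le> \<mu> * (v \<bullet> x)"
    using mat_le_form[OF le, of v] by (simp add: scaleR_matrix_vector_assoc[symmetric] x)
  then have "c * c * (v \<bullet> (W' *v v)) \<le> c * c * (\<mu> * (v \<bullet> x))"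
    by (rule mult_left_mono) simp
  then have "c * c * (v \<bullet> (W' *v v)) \<le> c * (v \<bullet> x)"
    unfolding mult.assoc[symmetric] c .
  ultimately have "c * (v \<bullet> x) \<le> inv_form W' x" by linarith
  then show ?thesis
    using \<open>0 < \<mu>\<close> by (simp add: inv_form_def[of W] v_def[symmetric] c_def inner_commute field_simps)
qed

lemma pulled_form_mono:
  assumes "A \<preceq>\<^sub>m \<mu> *\<^sub>R B"
  shows "pulled_form Z A x \<le> \<mu> * pulled_form Z B x"
  using mat_le_form[OF assms] by (simp add: pulled_form_def scaleR_matrix_vector_assoc[symmetric])

text \<open>
  The \<open>\<Psi>\<close> hypotheses contain \<open>Z + Z\<^sup>T - W\<close>, the linearisation of \<open>Z\<^sup>T W\<^sup>-\<^sup>1 Z\<close>. By duality the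
  linearisation is the smaller one, so that it may be replaced by the form of the inverse that
  occurs in the functional.
\<close>

lemma slack_inequality:
  fixes Z W :: "real^'d::finite^'d"
  assumes psd: "pos_semidef (sym_block (sym_block X11 X12 X22) (vcat M1 M2) (Z + transpose Z - W))"
    and W: "pos_def W" and Z: "invertible Z"
  shows "0 \<le> a \<bullet> (X11 *v a) + 2 * (a \<bullet> (X12 *v b)) + b \<bullet> (X22 *v b)
    + 2 * (a \<bullet> (M1 *v (matrix_inv Z *v e)) + b \<bullet> (M2 *v (matrix_inv Z *v e))) + inv_form W e"
proof -
  define y where "y = matrix_inv Z *v e"
  have e: "e = Z *v y" using Z by (simp add: y_def matrix_inv_mult)
  have "0 \<le> vjoin (vjoin a b) y \<bullet> (sym_block (sym_block X11 X12 X22) (vcat M1 M2) (Z + transpose Z - W) *v vjoin (vjoin a b) y)"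
    using psd by (simp add: pos_semidef_def)
  also have "\<dots> = a \<bullet> (X11 *v a) + 2 * (a \<bullet> (X12 *v b)) + b \<bullet> (X22 *v b)
    + 2 * (a \<bullet> (M1 *v y) + b \<bullet> (M2 *v y)) + (2 * (e \<bullet> y) - y \<bullet> (W *v y))"
    by (simp add: sym_block_form vcat_mult inner_vjoin matrix_vector_mult_diff_rdistrib
        matrix_vector_mult_add_rdistrib inner_add_right inner_diff_right inner_transpose e inner_commute)
  finally show ?thesis unfolding y_def[symmetric] using inv_form_ge[OF W, of e y] by linarith
qed

text \<open>
  The gain involves the inverse of \<open>Z\<close>; it exists because \<open>\<Psi>\<close> forces \<open>Z + Z\<^sup>T \<ge> W > 0\<close>.
\<close>

lemma slack_invertible:
  fixes Z W :: "real^'d::finite^'d"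
  assumes psd: "pos_semidef (sym_block X M (Z + transpose Z - W))"  and W: "pos_def W"
  shows "invertible Z"
  unfolding invertible_iff_ker
proof (intro allI impI)
  fix x assume x: "Z *v x = 0"
  have "0 \<le> vjoin 0 x \<bullet> (sym_block X M (Z + transpose Z - W) *v vjoin 0 x)"
    using psd by (simp add: pos_semidef_def)
  also have "\<dots> = - (x \<bullet> (W *v x))"
    by (simp add: sym_block_form matrix_vector_mult_diff_rdistrib
        matrix_vector_mult_add_rdistrib inner_add_right inner_diff_right inner_transpose x)
  finally show "x = 0" using pos_def_pos[OF W, of x] by fastforce
qed

lemma young_uncertainty:
  assumes F: "transpose F ** F \<preceq>\<^sub>m mat 1" and "0 < \<delta>"
  shows "2 * (g \<bullet> (F *v e)) \<le> \<delta> * (g \<bullet> g) + 1 / \<delta> * (e \<bullet> e)"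
proof -
  have "(F *v e) \<bullet> (F *v e) \<le> e \<bullet> e"
    using mat_le_form[OF F, of e] by (simp add: matrix_vector_mul_assoc[symmetric] inner_transpose)
  then have "1 / \<delta> * ((F *v e) \<bullet> (F *v e)) \<le> 1 / \<delta> * (e \<bullet> e)"
    using \<open>0 < \<delta>\<close> by (intro mult_left_mono) auto
  moreover have "0 \<le> 1 / \<delta> * ((\<delta> *\<^sub>R g - F *v e) \<bullet> (\<delta> *\<^sub>R g - F *v e))"
    using \<open>0 < \<delta>\<close> by simp
  then have "2 * (g \<bullet> (F *v e)) \<le> \<delta> * (g \<bullet> g) + 1 / \<delta> * ((F *v e) \<bullet> (F *v e))"
    using \<open>0 < \<delta>\<close> by (simp add: inner_diff inner_commute field_simps)
  ultimately show ?thesis by linarith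
qed

text \<open>
  Each fault has the shape \<open>\<omega> = m (1 + \<theta>)\<close> with \<open>m\<close> the mean of its bounds and \<open>\<bar>\<theta>\<bar> \<le> \<xi>\<close>. If both
  bounds vanish, then \<open>\<xi> = 0 / 0 = 0\<close>, which is consistent because \<open>\<omega> = m = 0\<close>.
\<close>

lemma young_fault:
  fixes x w :: "real^'u::finite"
  assumes \<omega>: "\<And>l. 0 \<le> \<omega>L l \<and> \<omega>L l \<le> \<omega> l \<and> \<omega> l \<le> \<omega>H l" and "0 < \<epsilon>"
  defines "x' \<equiv> transpose (Omega0 \<omega>L \<omega>H) *v x"
  shows "2 * (x \<bullet> (diag_mat \<omega> *v w - Omega0 \<omega>L \<omega>H *v w))
    \<le> \<epsilon> * (x' \<bullet> (Xi \<omega>L \<omega>H *v x')) + 1 / \<epsilon> * (w \<bullet> (Xi \<omega>L \<omega>H *v w))"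
proof -
  define m where "m l = (\<omega>L l + \<omega>H l) / 2" for l
  define \<xi> where "\<xi> l = (\<omega>H l - \<omega>L l) / (\<omega>H l + \<omega>L l)" for l
  have tr: "transpose (Omega0 \<omega>L \<omega>H) = Omega0 \<omega>L \<omega>H"
    by (auto simp: Omega0_def diag_mat_def transpose_def vec_eq_iff)
  have comp: "2 * (x $ l * (\<omega> l * w $ l)) - 2 * (x $ l * (m l * w $ l))
    \<le> \<epsilon> * (\<xi> l * (m l * x $ l * (m l * x $ l))) + 1 / \<epsilon> * (\<xi> l * (w $ l * w $ l))" for l
  proof -
    have \<xi>: "0 \<le> \<xi> l" using \<omega>[of l] by (auto simp: \<xi>_def)
    have "\<bar>\<omega> l - m l\<bar> \<le> \<xi> l * m l"
    proof (cases "\<omega>H l + \<omega>L l = 0")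
      case True
      then have "\<omega>H l = 0" "\<omega>L l = 0" "\<omega> l = 0" using \<omega>[of l] by linarith+
      then show ?thesis by (simp add: m_def)
    next
      case False
      then have "\<xi> l * m l = (\<omega>H l - \<omega>L l) / 2" unfolding \<xi>_def m_def by (simp add: add.commute)
      moreover have "\<bar>\<omega> l - (\<omega>L l + \<omega>H l) / 2\<bar> \<le> (\<omega>H l - \<omega>L l) / 2"
        using conjunct1[OF conjunct2[OF \<omega>[of l]]] conjunct2[OF conjunct2[OF \<omega>[of l]]] by (simp add: abs_le_iff field_simps)
      ultimately show ?thesis unfolding m_def by simp
    qed
    then have "\<bar>\<omega> l - m l\<bar> * (\<bar>x $ l\<bar> * \<bar>w $ l\<bar>) \<le> \<xi> l * m l * (\<bar>x $ l\<bar> * \<bar>w $ l\<bar>)"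
      by (rule mult_right_mono) simp
    moreover have "(\<omega> l - m l) * (x $ l * w $ l) \<le> \<bar>\<omega> l - m l\<bar> * (\<bar>x $ l\<bar> * \<bar>w $ l\<bar>)"
      using abs_ge_self[of "(\<omega> l - m l) * (x $ l * w $ l)"] by (simp only: abs_mult)
    moreover have "0 \<le> \<xi> l * (1 / \<epsilon> * (\<epsilon> * (m l * \<bar>x $ l\<bar>) - \<bar>w $ l\<bar>)\<^sup>2)"
      using \<xi> \<open>0 < \<epsilon>\<close> by simp
    moreover have "1 / \<epsilon> * (\<epsilon> * (m l * \<bar>x $ l\<bar>) - \<bar>w $ l\<bar>)\<^sup>2
      = \<epsilon> * (m l * m l * \<bar>x $ l\<bar>\<^sup>2) + 1 / \<epsilon> * \<bar>w $ l\<bar>\<^sup>2 - 2 * (m l * (\<bar>x $ l\<bar> * \<bar>w $ l\<bar>))"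
      using \<open>0 < \<epsilon>\<close> unfolding power2_eq_square by (simp add: field_simps del: abs_mult_self_eq)
    then have "\<xi> l * (1 / \<epsilon> * (\<epsilon> * (m l * \<bar>x $ l\<bar>) - \<bar>w $ l\<bar>)\<^sup>2)
      = \<epsilon> * (\<xi> l * (m l * x $ l * (m l * x $ l))) + 1 / \<epsilon> * (\<xi> l * (w $ l * w $ l)) - 2 * (\<xi> l * m l * (\<bar>x $ l\<bar> * \<bar>w $ l\<bar>))"
      unfolding power2_abs by (simp only: power2_eq_square right_diff_distrib distrib_left mult_ac)
    moreover have "2 * (x $ l * (\<omega> l * w $ l)) - 2 * (x $ l * (m l * w $ l)) = 2 * ((\<omega> l - m l) * (x $ l * w $ l))"
      by (simp add: algebra_simps)
    ultimately show ?thesis by linarith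
  qed
  have "(\<Sum>l\<in>UNIV. 2 * (x $ l * (\<omega> l * w $ l)) - 2 * (x $ l * (m l * w $ l)))
    \<le> (\<Sum>l\<in>UNIV. \<epsilon> * (\<xi> l * (m l * x $ l * (m l * x $ l))) + 1 / \<epsilon> * (\<xi> l * (w $ l * w $ l)))"
    by (intro sum_mono comp)
  then show ?thesis
    unfolding x'_def tr unfolding Xi_def Omega0_def m_def[symmetric] \<xi>_def[symmetric]
    unfolding inner_diff_right by (simp add: inner_vec_def diag_mat_mult sum_distrib_left sum_divide_distrib sum.distrib sum_subtractf mult_ac)
qed

text \<open>
  The vector \<open>g\<close> solves \<open>Z\<^sup>T g = P u\<close>. With it, the diagonal block \<open>\<Pi>\<close>, which contains the linearisation
  \<open>Z + Z\<^sup>T - P\<close>, still yields at least the form of \<open>P\<close> at \<open>u\<close>: the difference of the two sides is the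
  square \<open>(u - g)\<^sup>T P (u - g)\<close>.
\<close>

lemma pos_def_back_substitution:
  fixes u :: "real^'d::finite"
  assumes P: "pos_def P" and Z: "invertible Z"
  defines "g \<equiv> matrix_inv (transpose Z) *v (P *v u)"
  shows "u \<bullet> (P *v u) \<le> 2 * (g \<bullet> (Z *v u)) + (g \<bullet> (P *v g) - 2 * (g \<bullet> (Z *v g)))"
proof -
  have "invertible (transpose Z)" using Z transpose_invertible by blast
  then have g: "g \<bullet> (Z *v y) = y \<bullet> (P *v u)" for y
    by (subst inner_mult_left) (simp add: g_def matrix_inv_mult inner_commute)
  have "0 \<le> (u - g) \<bullet> (P *v (u - g))" by (rule pos_def_nonneg[OF P])
  then show ?thesis unfolding g using pos_def_symm[OF P, of u g]
    by (simp add: inner_diff matrix_vector_mult_diff_distrib)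
qed

text \<open>
  The final addition of \<open>lmi_dissipation\<close>, with every inner product abstracted to a real number so that
  only linear arithmetic remains.
\<close>

lemma robust_balance:
  fixes \<phi>1 \<phi>2 :: real
  assumes "\<phi>1 + \<phi>2 + l1 + l2 - (w1 + w2) - (w3 + w4) + G1 + G2 + (h + s1 - s2) + (b + t1 - t2) \<le> 0"
    and "l1 + l2 = e1 + e2 + f1 + f2 + g1 + g2 - r"
    and "e1 - w1 = E1" "e2 - w2 = E2" "f1 - w3 = F1" "f2 - w4 = F2"
    and "s1 - s2 = s" "t1 - t2 = t" "r \<le> h + s + (b + t)"
    and "p1 \<le> g1 + G1" "p2 \<le> g2 + G2"
  shows "\<phi>1 + \<phi>2 + (p1 + E1 + F1) + (p2 + E2 + F2) \<le> 0"
  using assms by linarith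

text \<open>
  The vectors \<open>a, b, c, d\<close> are the states multiplied by the inverse of \<open>Z\<close>, and \<open>u\<close> is the next state
  in the same coordinates, computed with the true (uncertain, faulty) system matrices. The block
  rows of \<open>\<Phi>\<close> contain only the nominal system; the deviation \<open>N - R\<close> is paired with the sum \<open>r\<close> of the
  auxiliary vectors and is dominated by the \<open>\<delta>\<close> and \<open>\<epsilon>\<close> terms by Young's inequality.
\<close>

lemma lmi_dissipation:
  fixes S :: "('h::finite, 'v::finite, 'u::finite, 'p::finite, 'q::finite) subsystem"
    and a1 b1 c1 d1 u1 :: "real^'h" and a2 b2 c2 d2 u2 :: "real^'v"
    and \<omega> \<omega>L \<omega>H :: "'u \<Rightarrow> real"
  assumes d: "0 < dhL" "dhL < dhH" "0 < dvL" "dvL < dvH"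
    and pos: "0 < \<delta>" "0 < \<epsilon>"
    and F: "transpose F ** F \<preceq>\<^sub>m mat 1"
    and \<omega>: "\<And>l. 0 \<le> \<omega>L l \<and> \<omega>L l \<le> \<omega> l \<and> \<omega> l \<le> \<omega>H l"
    and Ph: "pos_def (Pb Vh)" and Pv: "pos_def (Pb Vv)"
    and W1: "pos_def (W1b Vh)" "pos_def (W1b Vv)" and W2: "pos_def (W2b Vh)" "pos_def (W2b Vv)"
    and Z: "invertible Zh" "invertible Zv"
    and lmi: "Phi_bar \<alpha> dhL dhH dvL dvH \<delta> \<epsilon> S \<omega>L \<omega>H Vh Vv (block_diag Zh Zv) \<Upsilon> \<prec>\<^sub>m 0"
    and nxt: "vjoin (Zh *v u1) (Zv *v u2) = A_hat S F *v vjoin (Zh *v a1) (Zv *v a2)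
       + B_mat S *v (diag_mat \<omega> *v (\<Upsilon> *v vjoin a1 a2)) + Ad_hat S F *v vjoin (Zh *v b1) (Zv *v b2)"
  shows "delay_form \<alpha> dhL dhH Vh a1 b1 c1 d1 + delay_form \<alpha> dvL dvH Vv a2 b2 c2 d2
    + (u1 \<bullet> (Pb Vh *v u1) + real dhL * inv_form (W1b Vh) (Zh *v u1 - Zh *v a1)
       + (real dhH - real dhL) * inv_form (W2b Vh) (Zh *v u1 - Zh *v a1))
    + (u2 \<bullet> (Pb Vv *v u2) + real dvL * inv_form (W1b Vv) (Zv *v u2 - Zv *v a2)
       + (real dvH - real dvL) * inv_form (W2b Vv) (Zv *v u2 - Zv *v a2)) \<le> 0"
proof -
  let ?Z = "block_diag Zh Zv" and ?O = "Omega0 \<omega>L \<omega>H" and ?X = "Xi \<omega>L \<omega>H"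
  define x1 x2 where "x1 = Zh *v u1 - Zh *v a1" and "x2 = Zv *v u2 - Zv *v a2"
  \<comment> \<open>The choice for the last five blocks: \<open>e\<close> and \<open>f\<close> produce the increment forms of \<open>W1\<close> and \<open>W2\<close>,
      \<open>g\<close> the form of \<open>P\<close> at the next state, \<open>s\<close> and \<open>t\<close> the compensation of uncertainty and faults.\<close>
  define e1 where "e1 = real dhL *\<^sub>R (matrix_inv (W1b Vh) *v x1)"
  define e2 where "e2 = real dvL *\<^sub>R (matrix_inv (W1b Vv) *v x2)"
  define f1 where "f1 = (real dhH - real dhL) *\<^sub>R (matrix_inv (W2b Vh) *v x1)"
  define f2 where "f2 = (real dvH - real dvL) *\<^sub>R (matrix_inv (W2b Vv) *v x2)"
  define g1 where "g1 = matrix_inv (transpose Zh) *v (Pb Vh *v u1)"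
  define g2 where "g2 = matrix_inv (transpose Zv) *v (Pb Vv *v u2)"
  define y where "y = E_mat S *v (?Z *v vjoin a1 a2) + Ed_mat S *v (?Z *v vjoin b1 b2)"
  define w where "w = \<Upsilon> *v vjoin a1 a2"
  define s where "s = (1 / \<delta>) *\<^sub>R y"
  define t where "t = (1 / \<epsilon>) *\<^sub>R w"
  define r where "r = vjoin (e1 + f1 + g1) (e2 + f2 + g2)"
  define R where "R = A_mat S *v (?Z *v vjoin a1 a2) + B_mat S *v (?O *v w) + Ad_mat S *v (?Z *v vjoin b1 b2)"
  define N where "N = vjoin (Zh *v u1) (Zv *v u2)"
  define v where "v = vjoin (vjoin (vjoin a1 a2) (vjoin (vjoin b1 b2) (vjoin (vjoin c1 c2) (vjoin d1 d2))))
    (vjoin (vjoin e1 e2) (vjoin (vjoin f1 f2) (vjoin (vjoin g1 g2) (vjoin s t))))"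
  have "v \<bullet> (Phi_bar \<alpha> dhL dhH dvL dvH \<delta> \<epsilon> S \<omega>L \<omega>H Vh Vv ?Z \<Upsilon> *v v) \<le> 0"
    using lmi pos_def_nonneg[of "0 - Phi_bar \<alpha> dhL dhH dvL dvH \<delta> \<epsilon> S \<omega>L \<omega>H Vh Vv ?Z \<Upsilon>" v]
    by (simp add: mat_less_def matrix_vector_minus_left)
  note form = this[unfolded v_def Phi_bar_form[OF d], folded r_def w_def, folded R_def y_def]
  have NR: "N - R = H_mat S *v (F *v y) + B_mat S *v (diag_mat \<omega> *v w - ?O *v w)"
    unfolding N_def nxt R_def A_hat_def Ad_hat_def y_def w_def block_diag_mult_vjoin
    by (simp add: matrix_vector_mul_assoc[symmetric] algebra_simps)
  have "2 * (r \<bullet> (N - R)) = 2 * ((transpose (H_mat S) *v r) \<bullet> (F *v y))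
      + 2 * ((transpose (B_mat S) *v r) \<bullet> (diag_mat \<omega> *v w - ?O *v w))"
    unfolding NR inner_add_right by (simp only: inner_mult_left[of _ "H_mat S"] inner_mult_left[of _ "B_mat S"]) simp
  then have rob: "2 * (r \<bullet> (N - R)) \<le>
      \<delta> * ((transpose (H_mat S) *v r) \<bullet> (transpose (H_mat S) *v r)) + 1 / \<delta> * (y \<bullet> y)
     + (\<epsilon> * ((transpose ?O *v (transpose (B_mat S) *v r)) \<bullet> (?X *v (transpose ?O *v (transpose (B_mat S) *v r))))
        + 1 / \<epsilon> * (w \<bullet> (?X *v w)))"
    using young_uncertainty[OF F pos(1), of "transpose (H_mat S) *v r" y]
      young_fault[of \<omega>L \<omega> \<omega>H, OF \<omega> pos(2), of "transpose (B_mat S) *v r" w] by linarith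
  have s: "2 * (s \<bullet> y) - \<delta> * (s \<bullet> s) = 1 / \<delta> * (y \<bullet> y)"
    using pos by (simp add: s_def field_simps)
  have t: "2 * (t \<bullet> (?X *v w)) - \<epsilon> * (t \<bullet> (?X *v t)) = 1 / \<epsilon> * (w \<bullet> (?X *v w))"
    using pos by (simp add: t_def matrix_vector_mult_scaleR field_simps)
  have lin: "2 * (vjoin (e1 + f1) (e2 + f2) \<bullet> (R - ?Z *v vjoin a1 a2)) + 2 * (vjoin g1 g2 \<bullet> R)
    = 2 * (e1 \<bullet> x1) + 2 * (e2 \<bullet> x2) + 2 * (f1 \<bullet> x1) + 2 * (f2 \<bullet> x2) + 2 * (g1 \<bullet> (Zh *v u1)) + 2 * (g2 \<bullet> (Zv *v u2))
      - 2 * (r \<bullet> (N - R))"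
  proof -
    have r: "r = vjoin (e1 + f1) (e2 + f2) + vjoin g1 g2" by (simp add: r_def vjoin_add)
    have "2 * (vjoin (e1 + f1) (e2 + f2) \<bullet> (R - ?Z *v vjoin a1 a2)) + 2 * (vjoin g1 g2 \<bullet> R) + 2 * (r \<bullet> (N - R))
     = 2 * (vjoin (e1 + f1) (e2 + f2) \<bullet> (N - ?Z *v vjoin a1 a2)) + 2 * (vjoin g1 g2 \<bullet> N)"
      unfolding r by (simp add: inner_diff_right inner_add_left)
    then show ?thesis
      by (simp add: N_def x1_def x2_def block_diag_mult_vjoin vjoin_diff inner_vjoin inner_add_left inner_diff_right)
  qed
  have W: "2 * (e1 \<bullet> x1) - 1 / real dhL * (e1 \<bullet> (W1b Vh *v e1)) = real dhL * inv_form (W1b Vh) x1"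
      "2 * (e2 \<bullet> x2) - 1 / real dvL * (e2 \<bullet> (W1b Vv *v e2)) = real dvL * inv_form (W1b Vv) x2"
      "2 * (f1 \<bullet> x1) - 1 / (real dhH - real dhL) * (f1 \<bullet> (W2b Vh *v f1)) = (real dhH - real dhL) * inv_form (W2b Vh) x1"
      "2 * (f2 \<bullet> x2) - 1 / (real dvH - real dvL) * (f2 \<bullet> (W2b Vv *v f2)) = (real dvH - real dvL) * inv_form (W2b Vv) x2"
    unfolding e1_def e2_def f1_def f2_def using d by (intro inv_form_attained W1 W2; simp)+
  show ?thesis
    unfolding x1_def[symmetric] x2_def[symmetric]
    by (rule robust_balance[OF form lin W s t rob pos_def_back_substitution[OF Ph Z(1), of u1, folded g1_def]
      pos_def_back_substitution[OF Pv Z(2), of u2, folded g2_def]])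
qed

section \<open>The Lyapunov functional in one direction\<close>

text \<open>
  What the hypotheses on one mode say about a single direction. The coupling of the two directions is
  left to \<open>\<Phi>\<close>. Invertibility of \<open>Z\<close> is obtained from \<open>slack_invertible\<close> and recorded with the rest.
\<close>

definition feasible_direction :: "'d::finite lmi_vars \<Rightarrow> ('d, 'd) rmat \<Rightarrow> bool" where
  "feasible_direction V Z \<longleftrightarrow>
     pos_def (Pb V) \<and> pos_def (Q1b V) \<and> pos_def (Q2b V) \<and> pos_def (W1b V) \<and> pos_def (W2b V) \<and>
     invertible Z \<and> pos_semidef (Psi1 V Z) \<and> pos_semidef (Psi2 V Z) \<and> pos_semidef (Psi3 V Z)"

definition lyapunov where
  "lyapunov \<alpha> l H Z V = delay_functional \<alpha> l H (pulled_form Z (Pb V)) (pulled_form Z (Q1b V)) (pulled_form Z (Q2b V))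
     (inv_form (W1b V)) (inv_form (W2b V))"

lemma pulled_form_nonneg: "pos_def A \<Longrightarrow> 0 \<le> pulled_form Z A x"
  unfolding pulled_form_def by (rule pos_def_nonneg)

lemma linear_slack: "linear (\<lambda>e. a \<bullet> (M1 *v (G *v e)) + b \<bullet> (M2 *v (G *v (e :: real^'d))))"
  by (rule linearI) (simp_all add: matrix_vector_right_distrib matrix_vector_mult_scaleR inner_add_right algebra_simps)

lemma lyapunov_step:
  fixes f :: "int \<Rightarrow> real^'d::finite"
  assumes "0 < \<alpha>" "\<alpha> \<le> 1" "l \<le> d" "d \<le> H" and V: "feasible_direction V Z"
  defines "g \<equiv> \<lambda>r. matrix_inv Z *v f r"
  shows "lyapunov \<alpha> l H Z V f (i + 1) - \<alpha> * lyapunov \<alpha> l H Z V f i \<le>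
    delay_form \<alpha> l H V (g i) (g (i - int d)) (g (i - int l)) (g (i - int H))
    + (g (i + 1) \<bullet> (Pb V *v g (i + 1)) + real l * inv_form (W1b V) (f (i + 1) - f i)
       + (real H - real l) * inv_form (W2b V) (f (i + 1) - f i))"
proof -
  let ?G = "matrix_inv Z" and ?a = "g i" and ?b = "g (i - int d)"
  have Z: "invertible Z" and W: "pos_def (W1b V)" "pos_def (W2b V)"
    using V by (auto simp: feasible_direction_def)
  have psi: "pos_semidef (sym_block (sym_block (X11b V) (X12b V) (X22b V)) (vcat (M1b V) (M2b V)) (Z + transpose Z - W1b V))"
    "pos_semidef (sym_block (sym_block (Y11b V) (Y12b V) (Y22b V)) (vcat (N1b V) (N2b V)) (Z + transpose Z - W2b V))"
    "pos_semidef (sym_block (sym_block (Y11b V) (Y12b V) (Y22b V)) (vcat (S1b V) (S2b V)) (Z + transpose Z - W2b V))"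
    using V by (auto simp: feasible_direction_def Psi1_def Psi2_def Psi3_def Xb_def Yb_def)
  note slack = slack_inequality[OF psi(1) W(1) Z, of ?a ?b] slack_inequality[OF psi(2) W(2) Z, of ?a ?b]
    slack_inequality[OF psi(3) W(2) Z, of ?a ?b]
  show ?thesis
    unfolding lyapunov_def delay_form_def
    using delay_functional_step[OF assms(1-4) inv_form_nonneg[OF W(1)] inv_form_nonneg[OF W(2)] linear_slack linear_slack linear_slack slack,
        of "pulled_form Z (Pb V)" "pulled_form Z (Q1b V)" "pulled_form Z (Q2b V)" f i]
    unfolding pulled_form_def g_def by (simp add: matrix_vector_mult_diff_distrib[of ?G])
qed

text \<open>
  Passing from \<open>W\<close> to its inverse reverses the order, hence the swapped roles of \<open>V\<close> and \<open>V'\<close> in the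
  last two hypotheses.
\<close>

lemma lyapunov_mono:
  assumes "0 \<le> \<alpha>" "0 < \<mu>" "feasible_direction V Z" "feasible_direction V' Z"
    and "Pb V \<preceq>\<^sub>m \<mu> *\<^sub>R Pb V'" "Q1b V \<preceq>\<^sub>m \<mu> *\<^sub>R Q1b V'" "Q2b V \<preceq>\<^sub>m \<mu> *\<^sub>R Q2b V'"
      "W1b V' \<preceq>\<^sub>m \<mu> *\<^sub>R W1b V" "W2b V' \<preceq>\<^sub>m \<mu> *\<^sub>R W2b V"
  shows "lyapunov \<alpha> l H Z V f i \<le> \<mu> * lyapunov \<alpha> l H Z V' f i"
  unfolding lyapunov_def using assms
  by (intro delay_functional_mono pulled_form_mono inv_form_antimono) (auto simp: feasible_direction_def)

lemma matrix_form_bounded: "\<exists>c\<ge>0. \<forall>x. x \<bullet> (A *v x) \<le> c * (norm (x :: real^'d::finite))\<^sup>2"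
proof -
  obtain c where c: "0 < c" "\<And>x. norm (A *v x) \<le> norm x * c"
    using bounded_linear.pos_bounded[OF matrix_vector_mul_bounded_linear, of A] by blast
  have "x \<bullet> (A *v x) \<le> c * (norm x)\<^sup>2" for x
  proof -
    have "x \<bullet> (A *v x) \<le> norm x * norm (A *v x)" by (rule norm_cauchy_schwarz)
    also have "\<dots> \<le> norm x * (norm x * c)" by (intro mult_left_mono c) simp
    finally show ?thesis by (simp add: power2_eq_square mult_ac)
  qed
  then show ?thesis using c(1) less_imp_le by blast
qed

lemma pulled_form_eq: "pulled_form Z A x = x \<bullet> ((transpose (matrix_inv Z) ** A ** matrix_inv Z) *v x)"
  unfolding pulled_form_def matrix_vector_mul_assoc[symmetric] inner_transpose by (rule inner_commute)

text \<open>
  The constant is the minimum of the form on the compact unit sphere.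
\<close>

lemma positive_form_coercive:
  assumes "\<And>x :: real^'d::finite. x \<noteq> 0 \<Longrightarrow> 0 < x \<bullet> (A *v x)"
  shows "\<exists>c>0. \<forall>x. c * (norm x)\<^sup>2 \<le> x \<bullet> (A *v x)"
proof -
  have "\<exists>u\<in>sphere 0 1. \<forall>x\<in>sphere (0 :: real^'d) 1. u \<bullet> (A *v u) \<le> x \<bullet> (A *v x)"
    by (intro continuous_attains_inf) (auto intro!: continuous_intros matrix_vector_mult_linear_continuous_on)
  then obtain u where u: "norm u = 1" "\<And>x. norm x = 1 \<Longrightarrow> u \<bullet> (A *v u) \<le> x \<bullet> (A *v x)"
    by auto
  have "u \<bullet> (A *v u) * (norm x)\<^sup>2 \<le> x \<bullet> (A *v x)" for x
  proof (cases "x = 0")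
    case False
    define y where "y = x /\<^sub>R norm x"
    have x: "x = norm x *\<^sub>R y" using False by (simp add: y_def)
    have "norm y = 1" using False by (simp add: y_def)
    then have "u \<bullet> (A *v u) * (norm x)\<^sup>2 \<le> y \<bullet> (A *v y) * (norm x)\<^sup>2" by (intro mult_right_mono u) auto
    also have "\<dots> = (norm x *\<^sub>R y) \<bullet> (A *v (norm x *\<^sub>R y))"
      by (simp add: matrix_vector_mult_scaleR power2_eq_square)
    also have "\<dots> = x \<bullet> (A *v x)" using x by simp
    finally show ?thesis .
  qed simp
  moreover have "0 < u \<bullet> (A *v u)" using u(1) by (intro assms) auto
  ultimately show ?thesis by blast
qed

lemma lyapunov_coercive:
  assumes "0 \<le> \<alpha>" and V: "feasible_direction V Z"
  shows "\<exists>c>0. \<forall>f i. (norm (f i))\<^sup>2 \<le> c * lyapunov \<alpha> l H Z V f i"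
proof -
  have "0 < pulled_form Z (Pb V) x" if "x \<noteq> 0" for x
  proof -
    have "matrix_inv Z *v x \<noteq> 0"
      using that V matrix_inv_mult(1)[of Z x] by (auto simp: feasible_direction_def)
    then show ?thesis using V by (simp add: pulled_form_def pos_def_pos feasible_direction_def)
  qed
  then obtain c where c: "0 < c" "\<And>x. c * (norm x)\<^sup>2 \<le> pulled_form Z (Pb V) x"
    using positive_form_coercive[of "transpose (matrix_inv Z) ** Pb V ** matrix_inv Z"]
    unfolding pulled_form_eq by blast
  have "(norm (f i))\<^sup>2 \<le> 1 / c * lyapunov \<alpha> l H Z V f i" for f i
  proof -
    have "pulled_form Z (Pb V) (f i) \<le> lyapunov \<alpha> l H Z V f i"
      unfolding lyapunov_def using V assms(1)
      by (intro delay_functional_ge) (auto simp: feasible_direction_def pulled_form_nonneg inv_form_nonneg)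
    then have "c * (norm (f i))\<^sup>2 \<le> lyapunov \<alpha> l H Z V f i" using c(2)[of "f i"] by linarith
    then show ?thesis using c(1) by (simp add: field_simps)
  qed
  then show ?thesis using c(1) by (intro exI[of _ "1 / c"]) auto
qed

lemma lyapunov_bounded:
  assumes "0 \<le> \<alpha>" "\<alpha> \<le> 1" "l \<le> H" and V: "feasible_direction V Z"
  shows "\<exists>c\<ge>0. \<forall>f i. lyapunov \<alpha> l H Z V f i \<le> c * (\<Sum>r\<le>H. (norm (f (i - int r)))\<^sup>2)"
proof -
  obtain c1 where c1: "0 \<le> c1" "\<And>x. pulled_form Z (Pb V) x \<le> c1 * (norm x)\<^sup>2"
    using matrix_form_bounded unfolding pulled_form_eq by blast
  obtain c2 where c2: "0 \<le> c2" "\<And>x. pulled_form Z (Q1b V) x \<le> c2 * (norm x)\<^sup>2"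
    using matrix_form_bounded unfolding pulled_form_eq by blast
  obtain c3 where c3: "0 \<le> c3" "\<And>x. pulled_form Z (Q2b V) x \<le> c3 * (norm x)\<^sup>2"
    using matrix_form_bounded unfolding pulled_form_eq by blast
  obtain c4 where c4: "0 \<le> c4" "\<And>x. inv_form (W1b V) x \<le> c4 * (norm x)\<^sup>2"
    using matrix_form_bounded unfolding inv_form_def by blast
  obtain c5 where c5: "0 \<le> c5" "\<And>x. inv_form (W2b V) x \<le> c5 * (norm x)\<^sup>2"
    using matrix_form_bounded unfolding inv_form_def by blast
  define c where "c = c1 + c2 + c3 + c4 + c5"
  have le: "q \<le> c * (norm x)\<^sup>2" if "q \<le> c' * (norm x)\<^sup>2" "c' \<le> c" for q c' and x :: "real^'a"
    using that mult_right_mono[OF that(2), of "(norm x)\<^sup>2"] by simp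
  have c: "c1 \<le> c" "c2 \<le> c" "c3 \<le> c" "c4 \<le> c" "c5 \<le> c" "0 \<le> c"
    using c1(1) c2(1) c3(1) c4(1) c5(1) by (simp_all add: c_def)
  have "lyapunov \<alpha> l H Z V f i \<le> c * (3 + 4 * real H) * (\<Sum>r\<le>H. (norm (f (i - int r)))\<^sup>2)" for f i
    unfolding lyapunov_def using V assms(1-3)
    by (intro delay_functional_le c le[OF c1(2)] le[OF c2(2)] le[OF c3(2)] le[OF c4(2)] le[OF c5(2)])
      (auto simp: feasible_direction_def pulled_form_nonneg inv_form_nonneg)
  then show ?thesis using \<open>0 \<le> c\<close> by (intro exI[of _ "c * (3 + 4 * real H)"]) auto
qed

lemma lyapunov_nonneg:
  assumes "0 \<le> \<alpha>" and V: "feasible_direction V Z"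
  shows "0 \<le> lyapunov \<alpha> l H Z V f i"
proof -
  have "pulled_form Z (Pb V) (f i) \<le> lyapunov \<alpha> l H Z V f i"
    unfolding lyapunov_def using V assms(1)
    by (intro delay_functional_ge) (auto simp: feasible_direction_def pulled_form_nonneg inv_form_nonneg)
  then show ?thesis using V pulled_form_nonneg[of "Pb V" Z "f i"] by (simp add: feasible_direction_def)
qed

text \<open>
  Vanishing boundary data make a new row or column start with zero energy.
\<close>

lemma lyapunov_zero:
  assumes "0 \<le> \<alpha>" "\<alpha> \<le> 1" "l \<le> H" and V: "feasible_direction V Z"
    and "\<And>r. i - int H \<le> r \<Longrightarrow> r \<le> i \<Longrightarrow> f r = 0"
  shows "lyapunov \<alpha> l H Z V f i = 0"
proof -
  obtain c where "lyapunov \<alpha> l H Z V f i \<le> c * (\<Sum>r\<le>H. (norm (f (i - int r)))\<^sup>2)"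
    using lyapunov_bounded[OF assms(1-4)] by blast
  then have "lyapunov \<alpha> l H Z V f i \<le> 0" using assms(5) by simp
  with lyapunov_nonneg[OF assms(1) V] show ?thesis by (meson order_antisym)
qed

section \<open>Summation along diagonals\<close>

definition diag_lyapunov where
  "diag_lyapunov \<alpha> dhL dhH dvL dvH Zh Zv Vh Vv xh xv D =
     (\<Sum>i\<le>D. lyapunov \<alpha> dhL dhH Zh Vh (\<lambda>r. xh r (D - i)) (int i)
            + lyapunov \<alpha> dvL dvH Zv Vv (xv i) (int (D - i)))"

text \<open>
  On the diagonal \<open>D + 1\<close> the index \<open>(i + 1, j)\<close> of a horizontal and \<open>(i, j + 1)\<close> of a vertical summand
  both come from the cell \<open>(i, j)\<close> of the diagonal \<open>D\<close>; the two summands without a predecessor vanish.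
\<close>

lemma diag_lyapunov_Suc:
  assumes "0 \<le> \<alpha>" "\<alpha> \<le> 1" "dhL \<le> dhH" "dvL \<le> dvH" and V: "feasible_direction Vh Zh" "feasible_direction Vv Zv"
    and "\<And>r. - int dhH \<le> r \<Longrightarrow> r \<le> 0 \<Longrightarrow> xh r (Suc D) = 0" "\<And>r. - int dvH \<le> r \<Longrightarrow> r \<le> 0 \<Longrightarrow> xv (Suc D) r = 0"
  shows "diag_lyapunov \<alpha> dhL dhH dvL dvH Zh Zv Vh Vv xh xv (Suc D) =
     (\<Sum>i\<le>D. lyapunov \<alpha> dhL dhH Zh Vh (\<lambda>r. xh r (D - i)) (int i + 1)
            + lyapunov \<alpha> dvL dvH Zv Vv (xv i) (int (D - i) + 1))"
proof -
  have h0: "lyapunov \<alpha> dhL dhH Zh Vh (\<lambda>r. xh r (Suc D)) 0 = 0"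
    using assms by (intro lyapunov_zero) auto
  have v0: "lyapunov \<alpha> dvL dvH Zv Vv (xv (Suc D)) 0 = 0"
    using assms by (intro lyapunov_zero) auto
  have "(\<Sum>i\<le>Suc D. lyapunov \<alpha> dhL dhH Zh Vh (\<lambda>r. xh r (Suc D - i)) (int i))
     = (\<Sum>i\<le>D. lyapunov \<alpha> dhL dhH Zh Vh (\<lambda>r. xh r (D - i)) (int i + 1))"
    by (subst sum.atMost_Suc_shift) (simp add: h0 add.commute)
  moreover have "(\<Sum>i\<le>Suc D. lyapunov \<alpha> dvL dvH Zv Vv (xv i) (int (Suc D - i)))
     = (\<Sum>i\<le>D. lyapunov \<alpha> dvL dvH Zv Vv (xv i) (int (D - i) + 1))"
    by (simp add: v0 Suc_diff_le algebra_simps)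
  ultimately show ?thesis unfolding diag_lyapunov_def sum.distrib by (simp only:)
qed

lemma diag_lyapunov_mono:
  assumes "\<And>f i. lyapunov \<alpha> dhL dhH Zh Vh f i \<le> \<mu> * lyapunov \<alpha> dhL dhH Zh Vh' f i"
    "\<And>f i. lyapunov \<alpha> dvL dvH Zv Vv f i \<le> \<mu> * lyapunov \<alpha> dvL dvH Zv Vv' f i"
  shows "diag_lyapunov \<alpha> dhL dhH dvL dvH Zh Zv Vh Vv xh xv D \<le> \<mu> * diag_lyapunov \<alpha> dhL dhH dvL dvH Zh Zv Vh' Vv' xh xv D"
  unfolding diag_lyapunov_def sum_distrib_left distrib_left by (intro sum_mono add_mono assms)

lemma diag_lyapunov_coercive:
  assumes "0 \<le> \<alpha>" and V: "feasible_direction Vh Zh" "feasible_direction Vv Zv"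
  shows "\<exists>c>0. \<forall>xh xv D. diag_energy xh xv D \<le> c * diag_lyapunov \<alpha> dhL dhH dvL dvH Zh Zv Vh Vv xh xv D"
proof -
  obtain ch where ch: "0 < ch" "\<And>f i. (norm (f i))\<^sup>2 \<le> ch * lyapunov \<alpha> dhL dhH Zh Vh f i"
    using lyapunov_coercive[OF assms(1) V(1)] by blast
  obtain cv where cv: "0 < cv" "\<And>f i. (norm (f i))\<^sup>2 \<le> cv * lyapunov \<alpha> dvL dvH Zv Vv f i"
    using lyapunov_coercive[OF assms(1) V(2)] by blast
  have "(norm (vjoin (xh (int i) j) (xv i (int j))))\<^sup>2
    \<le> max ch cv * (lyapunov \<alpha> dhL dhH Zh Vh (\<lambda>r. xh r j) (int i) + lyapunov \<alpha> dvL dvH Zv Vv (xv i) (int j))" for xh xv i j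
  proof -
    have "ch * lyapunov \<alpha> dhL dhH Zh Vh (\<lambda>r. xh r j) (int i) \<le> max ch cv * lyapunov \<alpha> dhL dhH Zh Vh (\<lambda>r. xh r j) (int i)"
      "cv * lyapunov \<alpha> dvL dvH Zv Vv (xv i) (int j) \<le> max ch cv * lyapunov \<alpha> dvL dvH Zv Vv (xv i) (int j)"
      by (intro mult_right_mono lyapunov_nonneg assms; simp)+
    moreover have "(norm (vjoin (xh (int i) j) (xv i (int j))))\<^sup>2 = (norm (xh (int i) j))\<^sup>2 + (norm (xv i (int j)))\<^sup>2"
      by (simp add: power2_norm_eq_inner inner_vjoin)
    ultimately show ?thesis
      using ch(2)[of "\<lambda>r. xh r j" "int i"] cv(2)[of "xv i" "int j"] by (simp add: distrib_left)
  qed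
  then have "diag_energy xh xv D \<le> max ch cv * diag_lyapunov \<alpha> dhL dhH dvL dvH Zh Zv Vh Vv xh xv D" for xh xv D
    unfolding diag_energy_def diag_lyapunov_def sum_distrib_left by (intro sum_mono)
  then show ?thesis using ch(1) by (intro exI[of _ "max ch cv"]) auto
qed

text \<open>
  The offsets range over a finite set, so the supremum is an upper bound of its members.
\<close>

lemma diag_norm_C_upper:
  assumes "\<theta>h \<in> {- int dhH <.. 0}" "\<theta>v \<in> {- int dvH <.. 0}"
  shows "(\<Sum>i\<le>z. (norm (xh (int i + \<theta>h) (z - i)))\<^sup>2 + (norm (xv i (int (z - i) + \<theta>v)))\<^sup>2) \<le> diag_norm_C dhH dvH xh xv z"
    and "(\<Sum>i\<le>z. (norm (xh (int i + \<theta>h + 1) (z - i) - xh (int i + \<theta>h) (z - i)))\<^sup>2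
       + (norm (xv i (int (z - i) + \<theta>v + 1) - xv i (int (z - i) + \<theta>v)))\<^sup>2) \<le> diag_norm_C dhH dvH xh xv z"
proof -
  let ?g = "\<lambda>(\<theta>h, \<theta>v). max (\<Sum>i\<le>z. (norm (xh (int i + \<theta>h) (z - i)))\<^sup>2 + (norm (xv i (int (z - i) + \<theta>v)))\<^sup>2)
    (\<Sum>i\<le>z. (norm (xh (int i + \<theta>h + 1) (z - i) - xh (int i + \<theta>h) (z - i)))\<^sup>2
       + (norm (xv i (int (z - i) + \<theta>v + 1) - xv i (int (z - i) + \<theta>v)))\<^sup>2)"
  have "?g (\<theta>h, \<theta>v) \<le> diag_norm_C dhH dvH xh xv z"
    unfolding diag_norm_C_def Let_def using assms
    by (intro cSUP_upper2[where x = "(\<theta>h, \<theta>v)"] bdd_above_finite finite_imageI finite_cartesian_product) auto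
  then show "(\<Sum>i\<le>z. (norm (xh (int i + \<theta>h) (z - i)))\<^sup>2 + (norm (xv i (int (z - i) + \<theta>v)))\<^sup>2) \<le> diag_norm_C dhH dvH xh xv z"
    and "(\<Sum>i\<le>z. (norm (xh (int i + \<theta>h + 1) (z - i) - xh (int i + \<theta>h) (z - i)))\<^sup>2
       + (norm (xv i (int (z - i) + \<theta>v + 1) - xv i (int (z - i) + \<theta>v)))\<^sup>2) \<le> diag_norm_C dhH dvH xh xv z"
    by simp_all
qed

lemma norm_add_sq_le: "(norm x)\<^sup>2 \<le> 2 * (norm (x - y))\<^sup>2 + 2 * (norm (y :: 'a::real_inner))\<^sup>2"
  using norm_diff_sq_le[of "x - y" "- y"] by simp

text \<open>
  The window of length \<open>d\<^sub>H + 1\<close> ending on the diagonal \<open>z + 1\<close>. For \<open>r \<ge> 1\<close> the offset \<open>1 - r\<close> is one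
  of those in the supremum; for \<open>r = 0\<close> the value on \<open>z + 1\<close> is the value on \<open>z\<close> plus the increment at
  offset \<open>0\<close>, which the supremum also covers.
\<close>

lemma history_le_diag_norm_C:
  assumes "0 < dhH" "0 < dvH"
  shows "r \<le> dhH \<Longrightarrow> (\<Sum>i\<le>z. (norm (xh (int i + 1 - int r) (z - i)))\<^sup>2) \<le> 4 * diag_norm_C dhH dvH xh xv z"
    and "r \<le> dvH \<Longrightarrow> (\<Sum>i\<le>z. (norm (xv i (int (z - i) + 1 - int r)))\<^sup>2) \<le> 4 * diag_norm_C dhH dvH xh xv z"
proof -
  let ?C = "diag_norm_C dhH dvH xh xv z"
  note S = diag_norm_C_upper[where z = z and xh = xh and xv = xv and dhH = dhH and dvH = dvH]
  have split: "sum f {..z} \<le> ?C \<and> sum g {..z} \<le> ?C"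
    if "(\<Sum>i\<le>z. f i + g i) \<le> ?C" "\<And>i. 0 \<le> f i" "\<And>i. 0 \<le> g i" for f g :: "nat \<Rightarrow> real"
    using that(1) sum_nonneg[of "{..z}" f] sum_nonneg[of "{..z}" g] that(2,3) by (simp add: sum.distrib)
  have h: "(\<Sum>i\<le>z. (norm (xh (int i + \<theta>) (z - i)))\<^sup>2) \<le> ?C" if "\<theta> \<in> {- int dhH <.. 0}" for \<theta>
    using split[OF S(1)[OF that, of 0]] assms by simp
  have v: "(\<Sum>i\<le>z. (norm (xv i (int (z - i) + \<theta>)))\<^sup>2) \<le> ?C" if "\<theta> \<in> {- int dvH <.. 0}" for \<theta>
    using split[OF S(1)[OF _ that, of 0]] assms by simp
  have \<eta>: "(\<Sum>i\<le>z. (norm (xh (int i + 1) (z - i) - xh (int i) (z - i)))\<^sup>2) \<le> ?C"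
    "(\<Sum>i\<le>z. (norm (xv i (int (z - i) + 1) - xv i (int (z - i))))\<^sup>2) \<le> ?C"
    using split[OF S(2)[of 0 0]] assms by simp_all
  have "0 \<le> (\<Sum>i\<le>z. (norm (xh (int i + 0) (z - i)))\<^sup>2)" by (intro sum_nonneg) auto
  also have "\<dots> \<le> ?C" using assms by (intro h) auto
  finally have nn: "0 \<le> ?C" .
  show "(\<Sum>i\<le>z. (norm (xh (int i + 1 - int r) (z - i)))\<^sup>2) \<le> 4 * ?C" if "r \<le> dhH"
  proof (cases "r = 0")
    case True
    have "(\<Sum>i\<le>z. (norm (xh (int i + 1) (z - i)))\<^sup>2)
       \<le> (\<Sum>i\<le>z. 2 * (norm (xh (int i + 1) (z - i) - xh (int i) (z - i)))\<^sup>2 + 2 * (norm (xh (int i) (z - i)))\<^sup>2)"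
      by (intro sum_mono norm_add_sq_le)
    also have "\<dots> \<le> 2 * ?C + 2 * ?C"
      using \<eta>(1) h[of 0] assms by (simp add: sum.distrib sum_distrib_left[symmetric])
    finally show ?thesis using True by simp
  next
    case False
    have "(\<Sum>i\<le>z. (norm (xh (int i + (1 - int r)) (z - i)))\<^sup>2) \<le> ?C"
      using False that by (intro h) auto
    then show ?thesis using nn by (simp add: algebra_simps)
  qed
  show "(\<Sum>i\<le>z. (norm (xv i (int (z - i) + 1 - int r)))\<^sup>2) \<le> 4 * ?C" if "r \<le> dvH"
  proof (cases "r = 0")
    case True
    have "(\<Sum>i\<le>z. (norm (xv i (int (z - i) + 1)))\<^sup>2)
       \<le> (\<Sum>i\<le>z. 2 * (norm (xv i (int (z - i) + 1) - xv i (int (z - i))))\<^sup>2 + 2 * (norm (xv i (int (z - i))))\<^sup>2)"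
      by (intro sum_mono norm_add_sq_le)
    also have "\<dots> \<le> 2 * ?C + 2 * ?C"
      using \<eta>(2) v[of 0] assms by (simp add: sum.distrib sum_distrib_left[symmetric])
    finally show ?thesis using True by simp
  next
    case False
    have "(\<Sum>i\<le>z. (norm (xv i (int (z - i) + (1 - int r))))\<^sup>2) \<le> ?C"
      using False that by (intro v) auto
    then show ?thesis using nn by (simp add: algebra_simps)
  qed
qed

lemma diag_energy_le_norm_C:
  assumes "0 < dhH" "0 < dvH"
  shows "diag_energy xh xv z \<le> diag_norm_C dhH dvH xh xv z"
  using diag_norm_C_upper(1)[where \<theta>h = 0 and \<theta>v = 0 and dhH = dhH and dvH = dvH and z = z and xh = xh and xv = xv] assms
  by (simp add: diag_energy_def power2_norm_eq_inner inner_vjoin)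

lemma diag_lyapunov_initial:
  assumes "0 \<le> \<alpha>" "\<alpha> \<le> 1" "dhL \<le> dhH" "dvL \<le> dvH" "0 < dhH" "0 < dvH"
    and V: "feasible_direction Vh Zh" "feasible_direction Vv Zv"
  shows "\<exists>c\<ge>0. \<forall>xh xv. (\<forall>r. - int dhH \<le> r \<and> r \<le> 0 \<longrightarrow> xh r (Suc z) = 0) \<longrightarrow>
      (\<forall>r. - int dvH \<le> r \<and> r \<le> 0 \<longrightarrow> xv (Suc z) r = 0) \<longrightarrow>
      diag_lyapunov \<alpha> dhL dhH dvL dvH Zh Zv Vh Vv xh xv (Suc z) \<le> c * diag_norm_C dhH dvH xh xv z"
proof -
  obtain ch where ch: "0 \<le> ch" "\<And>f i. lyapunov \<alpha> dhL dhH Zh Vh f i \<le> ch * (\<Sum>r\<le>dhH. (norm (f (i - int r)))\<^sup>2)"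
    using lyapunov_bounded[OF assms(1-3) V(1)] by blast
  obtain cv where cv: "0 \<le> cv" "\<And>f i. lyapunov \<alpha> dvL dvH Zv Vv f i \<le> cv * (\<Sum>r\<le>dvH. (norm (f (i - int r)))\<^sup>2)"
    using lyapunov_bounded[OF assms(1,2,4) V(2)] by blast
  let ?c = "ch * (real (Suc dhH) * 4) + cv * (real (Suc dvH) * 4)"
  have "diag_lyapunov \<alpha> dhL dhH dvL dvH Zh Zv Vh Vv xh xv (Suc z) \<le> ?c * diag_norm_C dhH dvH xh xv z"
    if "\<forall>r. - int dhH \<le> r \<and> r \<le> 0 \<longrightarrow> xh r (Suc z) = 0" "\<forall>r. - int dvH \<le> r \<and> r \<le> 0 \<longrightarrow> xv (Suc z) r = 0" for xh xv
  proof -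
    let ?C = "diag_norm_C dhH dvH xh xv z"
    have "diag_lyapunov \<alpha> dhL dhH dvL dvH Zh Zv Vh Vv xh xv (Suc z) =
       (\<Sum>i\<le>z. lyapunov \<alpha> dhL dhH Zh Vh (\<lambda>r. xh r (z - i)) (int i + 1) + lyapunov \<alpha> dvL dvH Zv Vv (xv i) (int (z - i) + 1))"
      using that assms by (intro diag_lyapunov_Suc) auto
    also have "\<dots> \<le> (\<Sum>i\<le>z. ch * (\<Sum>r\<le>dhH. (norm (xh (int i + 1 - int r) (z - i)))\<^sup>2)
         + cv * (\<Sum>r\<le>dvH. (norm (xv i (int (z - i) + 1 - int r)))\<^sup>2))"
      by (intro sum_mono add_mono ch(2) cv(2))
    also have "\<dots> = ch * (\<Sum>r\<le>dhH. \<Sum>i\<le>z. (norm (xh (int i + 1 - int r) (z - i)))\<^sup>2)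
         + cv * (\<Sum>r\<le>dvH. \<Sum>i\<le>z. (norm (xv i (int (z - i) + 1 - int r)))\<^sup>2)"
      unfolding sum.distrib sum_distrib_left[symmetric]
      by (subst sum.swap, subst (2) sum.swap) (rule refl)
    also have "\<dots> \<le> ch * (\<Sum>r\<le>dhH. 4 * ?C) + cv * (\<Sum>r\<le>dvH. 4 * ?C)"
      using assms by (intro add_mono mult_left_mono sum_mono history_le_diag_norm_C ch(1) cv(1)) auto
    also have "\<dots> = ?c * ?C" by (simp add: algebra_simps)
    finally show ?thesis .
  qed
  moreover have "0 \<le> ?c" using ch(1) cv(1) by simp
  ultimately show ?thesis by blast
qed

section \<open>Switching and dwell time\<close>

lemma switches_Suc:
  assumes "z \<le> D"
  shows "switches \<sigma> z (Suc (Suc D)) = switches \<sigma> z (Suc D) + (if \<sigma> (Suc D) = \<sigma> D then 0 else 1)"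
proof -
  have "{m. z < m \<and> m < Suc (Suc D) \<and> \<sigma> m \<noteq> \<sigma> (m - 1)} =
    {m. z < m \<and> m < Suc D \<and> \<sigma> m \<noteq> \<sigma> (m - 1)} \<union> (if \<sigma> (Suc D) = \<sigma> D then {} else {Suc D})"
    using assms by (auto simp: less_Suc_eq)
  then show ?thesis unfolding switches_def by (simp add: card_insert_if)
qed

text \<open>
  A switch at the time \<open>D + 1\<close> costs \<open>\<mu>\<close> when the functional is re-expressed with the matrices of the new
  mode. As \<open>switches\<close> counts strictly below its last argument, the switches up to and
  including \<open>D\<close> are counted with \<open>Suc D\<close>.
\<close>

lemma switched_decay:
  fixes V :: "nat \<Rightarrow> nat \<Rightarrow> real"
  assumes "0 \<le> \<mu>"
    and step: "\<And>D. z \<le> D \<Longrightarrow> V (\<sigma> D) (Suc D) \<le> \<alpha> * V (\<sigma> D) D"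
    and switch: "\<And>D. V (\<sigma> (Suc D)) (Suc D) \<le> \<mu> * V (\<sigma> D) (Suc D)"
    and "0 \<le> \<alpha>" "z \<le> D"
  shows "V (\<sigma> D) D \<le> \<mu> ^ switches \<sigma> z (Suc D) * \<alpha> ^ (D - z) * V (\<sigma> z) z"
  using \<open>z \<le> D\<close>
proof (induction D rule: dec_induct)
  case base
  have "{m. z < m \<and> m < Suc z \<and> \<sigma> m \<noteq> \<sigma> (m - 1)} = {}" by auto
  then have "switches \<sigma> z (Suc z) = 0" unfolding switches_def by (simp only: card.empty)
  then show ?case by simp
next
  case (step D)
  let ?e = "if \<sigma> (Suc D) = \<sigma> D then 0 else 1 :: nat"
  have "V (\<sigma> (Suc D)) (Suc D) \<le> \<mu> ^ ?e * V (\<sigma> D) (Suc D)"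
    using switch[of D] by simp
  also have "\<dots> \<le> \<mu> ^ ?e * (\<alpha> * V (\<sigma> D) D)"
    using assms(1) assms(2)[OF step.hyps(1)] by (intro mult_left_mono) auto
  also have "\<dots> \<le> \<mu> ^ ?e * (\<alpha> * (\<mu> ^ switches \<sigma> z (Suc D) * \<alpha> ^ (D - z) * V (\<sigma> z) z))"
    using assms(1,4) step.IH by (intro mult_left_mono) auto
  also have "\<dots> = \<mu> ^ switches \<sigma> z (Suc (Suc D)) * \<alpha> ^ (Suc D - z) * V (\<sigma> z) z"
    using step.hyps by (simp add: switches_Suc Suc_diff_le power_add)
  finally show ?case .
qed

text \<open>
  The exponent is \<open>ln \<mu> (N\<^sub>0 + (D + 1 - z) / \<tau>\<^sub>a) + ln \<alpha> (D - z)\<close>, whose slope \<open>ln \<mu> / \<tau>\<^sub>a + ln \<alpha>\<close> is negative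
  exactly by the dwell time condition.
\<close>

lemma dwell_time_decay:
  assumes \<alpha>: "0 < \<alpha>" "\<alpha> < 1" and "1 \<le> \<mu>"
    and dwell: "average_dwell_time \<sigma> \<tau>a N0" "\<tau>a > ln \<mu> / (- ln \<alpha>)"
  shows "\<exists>c>0. \<exists>C>0. \<forall>z D. z \<le> D \<longrightarrow> \<mu> ^ switches \<sigma> z (Suc D) * \<alpha> ^ (D - z) \<le> C * exp (- c * (real D - real z))"
proof -
  have ln: "ln \<alpha> < 0" "0 \<le> ln \<mu>" using assms by auto
  then have "0 \<le> ln \<mu> / (- ln \<alpha>)" by (simp add: divide_nonneg_neg)
  then have \<tau>: "0 < \<tau>a" using dwell(2) by linarith
  define c where "c = - (ln \<mu> / \<tau>a + ln \<alpha>)"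
  define C where "C = exp (ln \<mu> * (N0 + 1 / \<tau>a))"
  have "ln \<mu> < \<tau>a * (- ln \<alpha>)" using dwell(2) ln(1) by (simp add: field_simps)
  then have "0 < c" using \<tau> by (simp add: c_def field_simps)
  moreover have "\<mu> ^ switches \<sigma> z (Suc D) * \<alpha> ^ (D - z) \<le> C * exp (- c * (real D - real z))" if "z \<le> D" for z D
  proof -
    have "real (switches \<sigma> z (Suc D)) \<le> N0 + (real (Suc D) - real z) / \<tau>a"
      using dwell(1) that unfolding average_dwell_time_def by (meson le_SucI)
    then have "ln \<mu> * real (switches \<sigma> z (Suc D)) \<le> ln \<mu> * (N0 + (real (Suc D) - real z) / \<tau>a)"
      using ln(2) by (rule mult_left_mono)
    moreover have "\<mu> ^ switches \<sigma> z (Suc D) = exp (ln \<mu> * real (switches \<sigma> z (Suc D)))"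
      using \<open>1 \<le> \<mu>\<close> by (simp add: exp_of_nat2_mult)
    moreover have "\<alpha> ^ (D - z) = exp (ln \<alpha> * (real D - real z))"
      using \<alpha>(1) that exp_of_nat2_mult[of "ln \<alpha>" "D - z"] by (simp add: of_nat_diff)
    ultimately have "\<mu> ^ switches \<sigma> z (Suc D) * \<alpha> ^ (D - z)
      \<le> exp (ln \<mu> * (N0 + (real (Suc D) - real z) / \<tau>a)) * exp (ln \<alpha> * (real D - real z))"
      by simp
    also have "\<dots> = C * exp (- c * (real D - real z))"
      unfolding C_def c_def exp_add[symmetric] using \<tau> by (simp add: field_simps)
    finally show ?thesis .
  qed
  ultimately show ?thesis using C_def by (metis exp_gt_zero)
qed

section \<open>Exponential stability of the closed loop\<close>

text \<open>
  For states written as \<open>Z\<close> times a vector the gain \<open>K = \<Upsilon> Z\<^sup>-\<^sup>1\<close> acts as \<open>\<Upsilon>\<close>, the quantity in which \<open>\<Phi>\<close> is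
  linear.
\<close>

lemma gain_in_Z_coordinates:
  fixes Zh :: "real^'h::finite^'h" and Zv :: "real^'v::finite^'v"
  assumes "invertible Zh" "invertible Zv"
  shows "(\<Upsilon> ** matrix_inv (block_diag Zh Zv)) *v vjoin x y = \<Upsilon> *v vjoin (matrix_inv Zh *v x) (matrix_inv Zv *v y)"
proof -
  let ?Z = "block_diag Zh Zv"
  have "invertible ?Z"
    unfolding invertible_iff_ker
  proof (intro allI impI)
    fix w assume "?Z *v w = 0"
    moreover obtain a b where "w = vjoin a b" by (rule vjoin_cases)
    ultimately show "w = 0"
      using assms unfolding invertible_iff_ker
      by (metis block_diag_mult_vjoin vjoin_eq_iff vjoin_zero)
  qed
  moreover have "vjoin x y = ?Z *v vjoin (matrix_inv Zh *v x) (matrix_inv Zv *v y)"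
    using assms by (simp add: block_diag_mult_vjoin matrix_inv_mult)
  ultimately show ?thesis
    by (simp add: matrix_vector_mul_assoc[symmetric] matrix_inv_mult)
qed

text \<open>
  The decay on a single cell. Only the sum of both directions decreases, as the subsystem
  couples the horizontal and the vertical state.
\<close>

lemma closed_loop_dissipation:
  fixes S :: "('h::finite, 'v::finite, 'u::finite, 'p::finite, 'q::finite) subsystem"
    and xh :: "int \<Rightarrow> real^'h" and xv :: "int \<Rightarrow> real^'v"
  assumes \<alpha>: "0 < \<alpha>" "\<alpha> \<le> 1"
    and d: "0 < dhL" "dhL < dhH" "0 < dvL" "dvL < dvH"
    and dh: "dhL \<le> dh" "dh \<le> dhH" and dv: "dvL \<le> dv" "dv \<le> dvH"
    and pos: "0 < \<delta>" "0 < \<epsilon>"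
    and F: "transpose F ** F \<preceq>\<^sub>m mat 1"
    and \<omega>: "\<And>l. 0 \<le> \<omega>L l \<and> \<omega>L l \<le> \<omega> l \<and> \<omega> l \<le> \<omega>H l"
    and V: "feasible_direction Vh Zh" "feasible_direction Vv Zv"
    and lmi: "Phi_bar \<alpha> dhL dhH dvL dvH \<delta> \<epsilon> S \<omega>L \<omega>H Vh Vv (block_diag Zh Zv) \<Upsilon> \<prec>\<^sub>m 0"
    and eq: "vjoin (xh (i + 1)) (xv (j + 1)) =
          (A_hat S F + B_mat S ** diag_mat \<omega> ** (\<Upsilon> ** matrix_inv (block_diag Zh Zv))) *v vjoin (xh i) (xv j)
        + Ad_hat S F *v vjoin (xh (i - int dh)) (xv (j - int dv))"
  shows "lyapunov \<alpha> dhL dhH Zh Vh xh (i + 1) + lyapunov \<alpha> dvL dvH Zv Vv xv (j + 1)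
    \<le> \<alpha> * (lyapunov \<alpha> dhL dhH Zh Vh xh i + lyapunov \<alpha> dvL dvH Zv Vv xv j)"
proof -
  let ?h = "\<lambda>r. matrix_inv Zh *v xh r" and ?v = "\<lambda>r. matrix_inv Zv *v xv r"
  have Z: "invertible Zh" "invertible Zv"
    and P: "pos_def (Pb Vh)" "pos_def (Pb Vv)"
    and W1: "pos_def (W1b Vh)" "pos_def (W1b Vv)" and W2: "pos_def (W2b Vh)" "pos_def (W2b Vv)"
    using V by (auto simp: feasible_direction_def)
  have nxt: "vjoin (Zh *v ?h (i + 1)) (Zv *v ?v (j + 1)) = A_hat S F *v vjoin (Zh *v ?h i) (Zv *v ?v j)
       + B_mat S *v (diag_mat \<omega> *v (\<Upsilon> *v vjoin (?h i) (?v j)))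
       + Ad_hat S F *v vjoin (Zh *v ?h (i - int dh)) (Zv *v ?v (j - int dv))"
    unfolding matrix_inv_mult(1)[OF Z(1)] matrix_inv_mult(1)[OF Z(2)] eq
      matrix_vector_mult_add_rdistrib matrix_vector_mul_assoc[of "B_mat S ** diag_mat \<omega>", symmetric]
      gain_in_Z_coordinates[OF Z]
    by (simp add: matrix_vector_mul_assoc matrix_mul_assoc)
  have "lyapunov \<alpha> dhL dhH Zh Vh xh (i + 1) - \<alpha> * lyapunov \<alpha> dhL dhH Zh Vh xh i +
      (lyapunov \<alpha> dvL dvH Zv Vv xv (j + 1) - \<alpha> * lyapunov \<alpha> dvL dvH Zv Vv xv j) \<le> 0"
    using add_mono[OF lyapunov_step[OF \<alpha> dh V(1), of xh i] lyapunov_step[OF \<alpha> dv V(2), of xv j]]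
      lmi_dissipation[OF d pos F \<omega> P W1 W2 Z lmi nxt, of "?h (i - int dhL)" "?h (i - int dhH)" "?v (j - int dvL)" "?v (j - int dvH)"]
    unfolding matrix_inv_mult(1)[OF Z(1)] matrix_inv_mult(1)[OF Z(2)] by linarith
  then show ?thesis by (simp add: algebra_simps)
qed

theorem theorem1:
  fixes N :: nat
    and S :: "nat \<Rightarrow> ('h::finite, 'v::finite, 'u::finite, 'p::finite, 'q::finite) subsystem"
    and F :: "nat \<Rightarrow> nat \<Rightarrow> nat \<Rightarrow> ('p, 'q) rmat"
    and \<omega> \<omega>L \<omega>H :: "nat \<Rightarrow> 'u \<Rightarrow> real"
    and \<sigma> dh dv :: "nat \<Rightarrow> nat"
    and dhL dhH dvL dvH z1 z2 z :: nat
    and \<alpha> \<mu> \<tau>a N0 :: real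
    and \<delta> \<epsilon> :: "nat \<Rightarrow> real"
    and Vh :: "nat \<Rightarrow> 'h lmi_vars" and Vv :: "nat \<Rightarrow> 'v lmi_vars"
    and Zh :: "('h, 'h) rmat" and Zv :: "('v, 'v) rmat"
    and \<Upsilon> K :: "nat \<Rightarrow> ('u, 'h + 'v) rmat"
  assumes switching: "\<And>m. \<sigma> m \<in> {1..N}"
    and delay_bounds: "0 < dhL" "dhL < dhH" "0 < dvL" "dvL < dvH"
    and delays: "\<And>i. dhL \<le> dh i \<and> dh i \<le> dhH" "\<And>j. dvL \<le> dv j \<and> dv j \<le> dvH"
    and uncertainty: "\<And>k i j. k \<in> {1..N} \<Longrightarrow> transpose (F k i j) ** F k i j \<preceq>\<^sub>m mat 1"
    and faults: "\<And>k l. k \<in> {1..N} \<Longrightarrow> 0 \<le> \<omega>L k l \<and> \<omega>L k l \<le> \<omega> k l \<and> \<omega> k l \<le> \<omega>H k l"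
    and boundary: "0 < z1" "0 < z2" "max z1 z2 \<le> z"
    and scalars: "0 < \<alpha>" "\<alpha> < 1" "\<And>k. k \<in> {1..N} \<Longrightarrow> 0 < \<delta> k \<and> 0 < \<epsilon> k"
    and positive: "\<And>k. k \<in> {1..N} \<Longrightarrow>
        pos_def (block_diag (Pb (Vh k)) (Pb (Vv k))) \<and>
        pos_def (block_diag (Q1b (Vh k)) (Q1b (Vv k))) \<and>
        pos_def (block_diag (Q2b (Vh k)) (Q2b (Vv k))) \<and>
        pos_def (block_diag (W1b (Vh k)) (W1b (Vv k))) \<and>
        pos_def (block_diag (W2b (Vh k)) (W2b (Vv k))) \<and>
        pos_def (Xb (Vh k)) \<and> pos_def (Xb (Vv k)) \<and>
        pos_def (Yb (Vh k)) \<and> pos_def (Yb (Vv k))"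
    and lmi_Phi: "\<And>k. k \<in> {1..N} \<Longrightarrow>
        Phi_bar \<alpha> dhL dhH dvL dvH (\<delta> k) (\<epsilon> k) (S k) (\<omega>L k) (\<omega>H k)
          (Vh k) (Vv k) (block_diag Zh Zv) (\<Upsilon> k) \<prec>\<^sub>m 0"
    and lmi_Psi: "\<And>k. k \<in> {1..N} \<Longrightarrow> 0 \<preceq>\<^sub>m Psi_bar (Vh k) (Vv k) Zh Zv"
    and controller: "\<And>k. k \<in> {1..N} \<Longrightarrow> K k = \<Upsilon> k ** matrix_inv (block_diag Zh Zv)"
    and mu: "1 \<le> \<mu>"
      "\<And>k l. k \<in> {1..N} \<Longrightarrow> l \<in> {1..N} \<Longrightarrow>
        within_factor \<mu> (block_diag (Pb (Vh k)) (Pb (Vv k))) (block_diag (Pb (Vh l)) (Pb (Vv l))) \<and>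
        within_factor \<mu> (block_diag (Q1b (Vh k)) (Q1b (Vv k))) (block_diag (Q1b (Vh l)) (Q1b (Vv l))) \<and>
        within_factor \<mu> (block_diag (Q2b (Vh k)) (Q2b (Vv k))) (block_diag (Q2b (Vh l)) (Q2b (Vv l))) \<and>
        within_factor \<mu> (block_diag (W1b (Vh k)) (W1b (Vv k))) (block_diag (W1b (Vh l)) (W1b (Vv l))) \<and>
        within_factor \<mu> (block_diag (W2b (Vh k)) (W2b (Vv k))) (block_diag (W2b (Vh l)) (W2b (Vv l)))"
    and dwell_time: "average_dwell_time \<sigma> \<tau>a N0" "\<tau>a > ln \<mu> / (- ln \<alpha>)"
  shows "exponentially_stable dhH dvH z
    {(xh, xv). closed_loop_equation S F (\<lambda>k. diag_mat (\<omega> k)) K \<sigma> dh dv xh xv \<and>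
               (\<exists>h v. boundary_conditions dhH dvH z1 z2 h v xh xv)}"
proof -
  let ?T = "{(xh, xv). closed_loop_equation S F (\<lambda>k. diag_mat (\<omega> k)) K \<sigma> dh dv xh xv \<and>
               (\<exists>h v. boundary_conditions dhH dvH z1 z2 h v xh xv)}"
  have feasible: "feasible_direction (Vh k) Zh" "feasible_direction (Vv k) Zv" if k: "k \<in> {1..N}" for k
  proof -
    have W: "pos_def (W1b (Vh k))" "pos_def (W1b (Vv k))"
      using positive[OF k] pos_def_block_diag by blast+
    have "pos_semidef (Psi_bar (Vh k) (Vv k) Zh Zv)"
      using lmi_Psi[OF k] by (simp add: mat_le_def)
    then have psi: "pos_semidef (Psi1 (Vh k) Zh)" "pos_semidef (Psi2 (Vh k) Zh)" "pos_semidef (Psi3 (Vh k) Zh)"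
        "pos_semidef (Psi1 (Vv k) Zv)" "pos_semidef (Psi2 (Vv k) Zv)" "pos_semidef (Psi3 (Vv k) Zv)"
      unfolding Psi_bar_def by (auto dest!: pos_semidef_block_diag)
    have "invertible Zh" "invertible Zv"
      using slack_invertible psi(1,4) W unfolding Psi1_def by blast+
    then show "feasible_direction (Vh k) Zh" "feasible_direction (Vv k) Zv"
      unfolding feasible_direction_def using positive[OF k] psi by (auto dest!: pos_def_block_diag)
  qed
  have mono: "lyapunov \<alpha> dhL dhH Zh (Vh k) f i \<le> \<mu> * lyapunov \<alpha> dhL dhH Zh (Vh l) f i"
    "lyapunov \<alpha> dvL dvH Zv (Vv k) g i \<le> \<mu> * lyapunov \<alpha> dvL dvH Zv (Vv l) g i"
    if kl: "k \<in> {1..N}" "l \<in> {1..N}" for k l f g i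
    using mu(2)[OF kl] feasible[OF kl(1)] feasible[OF kl(2)] scalars(1) mu(1) unfolding within_factor_def
    by (intro lyapunov_mono; blast intro: mat_le_block_diag less_imp_le order_less_le_trans[OF zero_less_one])+
  \<comment> \<open>\<open>L k\<close> is the functional of mode \<open>k\<close>; the uniform lower bound below is taken for the fixed mode \<open>\<sigma> 0\<close>
      and transferred to the active mode at the price of one factor \<open>\<mu>\<close>.\<close>
  define L where "L k = diag_lyapunov \<alpha> dhL dhH dvL dvH Zh Zv (Vh k) (Vv k)" for k
  have L_mono: "L k xh xv D \<le> \<mu> * L l xh xv D" if "k \<in> {1..N}" "l \<in> {1..N}" for k l xh xv D
    unfolding L_def using that by (intro diag_lyapunov_mono mono)
  have dH: "0 < dhH" "0 < dvH" "dhL \<le> dhH" "dvL \<le> dvH" using delay_bounds by auto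
  have \<alpha>: "0 \<le> \<alpha>" "\<alpha> \<le> 1" using scalars by auto
  note feasible_at = feasible[OF switching]
  obtain c C where c: "0 < c" and C: "0 < C"
    and decay: "\<And>z D. z \<le> D \<Longrightarrow> \<mu> ^ switches \<sigma> z (Suc D) * \<alpha> ^ (D - z) \<le> C * exp (- c * (real D - real z))"
    using dwell_time_decay[OF scalars(1,2) mu(1) dwell_time] by blast
  obtain a where a: "0 < a" "\<And>xh xv D. diag_energy xh xv D \<le> a * L (\<sigma> 0) xh xv D"
    unfolding L_def using diag_lyapunov_coercive[OF \<alpha>(1) feasible(1)[OF switching[of 0]] feasible(2)[OF switching[of 0]], of dhL dhH dvL dvH] by blast
  obtain b where b: "0 \<le> b" "\<And>xh xv. (\<forall>r. - int dhH \<le> r \<and> r \<le> 0 \<longrightarrow> xh r (Suc z) = 0) \<Longrightarrow>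
      (\<forall>r. - int dvH \<le> r \<and> r \<le> 0 \<longrightarrow> xv (Suc z) r = 0) \<Longrightarrow>
      L (\<sigma> (Suc z)) xh xv (Suc z) \<le> b * diag_norm_C dhH dvH xh xv z"
    unfolding L_def using diag_lyapunov_initial[OF \<alpha> dH(3,4,1,2) feasible(1)[OF switching[of "Suc z"]] feasible(2)[OF switching[of "Suc z"]], of z] by blast
  \<comment> \<open>The factor \<open>exp c\<close> accounts for starting at \<open>z + 1\<close>; the summand \<open>1\<close> covers \<open>D = z\<close>.\<close>
  define \<eta> where "\<eta> = 1 + a * \<mu> * C * exp c * b"
  have "0 \<le> a * \<mu> * C * exp c * b" using a(1) mu(1) C b(1) by simp
  then have \<eta>: "1 \<le> \<eta>" "a * \<mu> * C * exp c * b \<le> \<eta>" by (simp_all add: \<eta>_def)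
  have "diag_energy xh xv D \<le> \<eta> * exp (- c * (real D - real z)) * diag_norm_C dhH dvH xh xv z"
    if T: "(xh, xv) \<in> ?T" and D: "z \<le> D" for xh xv D
  proof -
    let ?n = "diag_norm_C dhH dvH xh xv z"
    from T obtain h v where loop: "closed_loop_equation S F (\<lambda>k. diag_mat (\<omega> k)) K \<sigma> dh dv xh xv"
      and bc: "boundary_conditions dhH dvH z1 z2 h v xh xv" by auto
    have h0: "xh r (Suc m) = 0" if "z \<le> m" "- int dhH \<le> r" "r \<le> 0" for m r
      using bc boundary that unfolding boundary_conditions_def by simp
    have v0: "xv (Suc m) r = 0" if "z \<le> m" "- int dvH \<le> r" "r \<le> 0" for m r
      using bc boundary that unfolding boundary_conditions_def by simp
    have "0 \<le> diag_energy xh xv z" by (simp add: diag_energy_def sum_nonneg)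
    with diag_energy_le_norm_C[OF dH(1,2), of xh xv z] have n: "0 \<le> ?n" by linarith
    have step: "L (\<sigma> m) xh xv (Suc m) \<le> \<alpha> * L (\<sigma> m) xh xv m" if m: "z \<le> m" for m
    proof -
      let ?k = "\<sigma> m"
      have cell: "lyapunov \<alpha> dhL dhH Zh (Vh ?k) (\<lambda>r. xh r (m - i)) (int i + 1)
          + lyapunov \<alpha> dvL dvH Zv (Vv ?k) (xv i) (int (m - i) + 1)
        \<le> \<alpha> * (lyapunov \<alpha> dhL dhH Zh (Vh ?k) (\<lambda>r. xh r (m - i)) (int i)
          + lyapunov \<alpha> dvL dvH Zv (Vv ?k) (xv i) (int (m - i)))" if i: "i \<le> m" for i
      proof -
        have k: "\<sigma> (i + (m - i)) = ?k" using i by simp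
        have eq: "vjoin (xh (int i + 1) (m - i)) (xv i (int (m - i) + 1)) =
            (A_hat (S ?k) (F ?k i (m - i)) + B_mat (S ?k) ** diag_mat (\<omega> ?k) ** (\<Upsilon> ?k ** matrix_inv (block_diag Zh Zv)))
              *v vjoin (xh (int i) (m - i)) (xv i (int (m - i)))
            + Ad_hat (S ?k) (F ?k i (m - i))
              *v vjoin (xh (int i - int (dh i)) (m - i)) (xv i (int (m - i) - int (dv (m - i))))"
          using loop unfolding closed_loop_equation_def Let_def controller[OF switching[of m], symmetric]
          by (metis k)
        show ?thesis
          using delays scalars(3)[OF switching[of m]]
          by (intro closed_loop_dissipation[OF scalars(1) \<alpha>(2) delay_bounds _ _ _ _ _ _
                uncertainty[OF switching] faults[OF switching] feasible_at lmi_Phi[OF switching] eq]) auto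
      qed
      have "L ?k xh xv (Suc m) = (\<Sum>i\<le>m. lyapunov \<alpha> dhL dhH Zh (Vh ?k) (\<lambda>r. xh r (m - i)) (int i + 1)
          + lyapunov \<alpha> dvL dvH Zv (Vv ?k) (xv i) (int (m - i) + 1))"
        unfolding L_def by (intro diag_lyapunov_Suc \<alpha> dH feasible_at h0 v0 m)
      also have "\<dots> \<le> \<alpha> * L ?k xh xv m"
        unfolding L_def diag_lyapunov_def sum_distrib_left by (intro sum_mono cell) simp
      finally show ?thesis .
    qed
    show ?thesis
    proof (cases "D = z")
      case True
      have "1 * ?n \<le> \<eta> * ?n" using \<eta>(1) n by (rule mult_right_mono)
      with diag_energy_le_norm_C[OF dH(1,2), of xh xv z] show ?thesis using True by simp
    next
      case False
      with D have D: "Suc z \<le> D" by simp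
      have "L (\<sigma> D) xh xv D \<le> \<mu> ^ switches \<sigma> (Suc z) (Suc D) * \<alpha> ^ (D - Suc z) * L (\<sigma> (Suc z)) xh xv (Suc z)"
        using mu(1) D \<alpha>(1)
        by (intro switched_decay[of \<mu> "Suc z" "\<lambda>k. L k xh xv"] step L_mono switching) auto
      also have "\<dots> \<le> \<mu> ^ switches \<sigma> (Suc z) (Suc D) * \<alpha> ^ (D - Suc z) * (b * ?n)"
        using mu(1) \<alpha>(1) by (intro mult_left_mono b(2)) (auto simp: h0 v0)
      also have "\<dots> \<le> C * exp (- c * (real D - real (Suc z))) * (b * ?n)"
        using b(1) n by (intro mult_right_mono decay D) auto
      finally have L: "L (\<sigma> D) xh xv D \<le> C * exp (- c * (real D - real (Suc z))) * (b * ?n)" .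
      have "diag_energy xh xv D \<le> a * (\<mu> * L (\<sigma> D) xh xv D)"
        using a L_mono[OF switching switching, of 0 xh xv D D] by (meson less_imp_le mult_left_mono order_trans)
      also have "\<dots> \<le> a * (\<mu> * (C * exp (- c * (real D - real (Suc z))) * (b * ?n)))"
        using a(1) mu(1) L by (intro mult_left_mono) auto
      also have "\<dots> = a * \<mu> * C * exp c * b * (exp (- c * (real D - real z)) * ?n)"
        by (simp add: exp_diff exp_minus algebra_simps exp_add)
      also have "\<dots> \<le> \<eta> * (exp (- c * (real D - real z)) * ?n)"
        using \<eta>(2) n by (intro mult_right_mono) auto
      finally show ?thesis by (simp only: mult.assoc)
    qed
  qed
  then show ?thesis
    unfolding exponentially_stable_def using c \<eta>(1)
    by (intro exI[of _ c] conjI exI[of _ \<eta>]) auto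
qed

end
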